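(* Let $K$ be a field, $F$ a free group of finite rank, $w\in F$, and let $Q$ be the $1\times 1$ matrix over $K[F]$ with $w-1$ as its single entry. The map $I\mapsto\iota(I^{*Q})$ is an involution on the set of algebraic extensions of the right ideal $(w-1)K[F]$ (that is, right ideals $I\le K[F]$ with $(w-1)K[F]\le_{\mathrm{alg}}I$), which preserves rank and inverts the order of inclusion.
   Context: $\mathcal{A}=K[F]$ is the free group algebra, with $K$-basis $F$. It is a free ideal ring: every submodule of a free (left or right) $\mathcal{A}$-module is free, of well-defined rank. The map $\iota:\mathcal{A}\to\mathcal{A}$ is the $K$-linear map with $\iota(u)=u^{-1}$ for $u\in F$; it maps left ideals to right ideals and vice versa, and $\iota(I)$ denotes the image of the ideal $I$. For a free $\mathcal{A}$-module $N$ and a submodule $M\le N$: $M$ is a free factor of $N$, written $M\le_* N$, if a basis of $M$ can be extended to a basis of $N$; the extension is algebraic, written $M\le_{\mathrm{alg}}N$, if there is no free factor $L$ of $N$ with $M\le L\subsetneq N$. $Q$-dual (for the $1\times1$ matrix $Q=(w-1)$): Let $I$ be a right ideal containing $w-1$. Choose a finitely generated free factor $I_{\mathrm{fin}}\le_* I$ containing $w-1$ (one exists) and a basis $f_1,\dots,f_t$ of $I_{\mathrm{fin}}$, and let $b_1,\dots,b_t\in\mathcal{A}$ be the unique elements with $w-1=\sum_{i=1}^t f_ib_i$. Then $I^{*Q}$ is the left ideal $\sum_{i=1}^t\mathcal{A}b_i$; it does not depend on the choices and contains $\mathcal{A}(w-1)$. *)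

theory Defs
  imports "HOL-Library.Poly_Mapping" "HOL-Library.Extended_Nat"
begin

text \<open>
  The class \<open>group_add\<close> does not assume commutativity, so an arbitrary group is written
  additively here: \<open>u + v\<close>, \<open>- u\<close> and \<open>0\<close> are the product \<open>uv\<close>, the inverse of \<open>u\<close> and the
  identity. With this convention the group algebra \<open>K[F]\<close> is the ring \<open>'f \<Rightarrow>\<^sub>0 'k\<close> of finitely
  supported functions with convolution as product, and \<open>u \<in> F\<close> corresponds to
  \<open>Poly_Mapping.single u 1\<close>.
\<close>

subsection \<open>Free groups\<close>

text \<open>A letter \<open>(x, True)\<close> stands for \<open>x\<close>, a letter \<open>(x, False)\<close> for its inverse.\<close>

definition word_value :: "('f::group_add \<times> bool) list \<Rightarrow> 'f" where
  "word_value ws = sum_list (map (\<lambda>(x, e). if e then x else - x) ws)"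

definition reduced_word :: "('f \<times> bool) list \<Rightarrow> bool" where
  "reduced_word ws \<longleftrightarrow> successively (\<lambda>(x, d) (y, e). x = y \<longrightarrow> d = e) ws"

definition free_group_basis :: "'f::group_add set \<Rightarrow> bool" where
  "free_group_basis X \<longleftrightarrow>
     (\<forall>g. \<exists>!ws. ws \<in> lists (X \<times> UNIV) \<and> reduced_word ws \<and> word_value ws = g)"

subsection \<open>Right ideals as right modules\<close>

definition right_ideal :: "'a::ring_1 set \<Rightarrow> bool" where
  "right_ideal I \<longleftrightarrow> 0 \<in> I \<and> (\<forall>x\<in>I. \<forall>y\<in>I. x + y \<in> I) \<and> (\<forall>x\<in>I. \<forall>r. x * r \<in> I)"

definition right_span :: "'a::ring_1 set \<Rightarrow> 'a set" where
  "right_span B = {\<Sum>f\<in>T. f * c f | T c. finite T \<and> T \<subseteq> B}"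

definition left_span :: "'a::ring_1 set \<Rightarrow> 'a set" where
  "left_span B = {\<Sum>f\<in>T. c f * f | T c. finite T \<and> T \<subseteq> B}"

definition right_independent :: "'a::ring_1 set \<Rightarrow> bool" where
  "right_independent B \<longleftrightarrow>
     (\<forall>T c. finite T \<and> T \<subseteq> B \<and> (\<Sum>f\<in>T. f * c f) = 0 \<longrightarrow> (\<forall>f\<in>T. c f = 0))"

text \<open>Bases may be infinite: a right ideal of \<open>K[F]\<close> need not be finitely generated.\<close>

definition right_basis :: "'a::ring_1 set \<Rightarrow> 'a set \<Rightarrow> bool" where
  "right_basis B I \<longleftrightarrow> right_independent B \<and> right_span B = I"

text \<open>
  The rank is well defined for right ideals of \<open>K[F]\<close> with \<open>F\<close> free, since these are free modules
  all of whose bases have the same cardinality. A basis is at most countable when \<open>F\<close> has finite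
  rank, so a single infinite value suffices.
\<close>

definition right_rank :: "'a::ring_1 set \<Rightarrow> enat" where
  "right_rank I =
     (THE r. \<exists>B. right_basis B I \<and> r = (if finite B then enat (card B) else \<infinity>))"

definition free_factor :: "'a::ring_1 set \<Rightarrow> 'a set \<Rightarrow> bool" where
  "free_factor M N \<longleftrightarrow> (\<exists>B C. right_basis B M \<and> B \<subseteq> C \<and> right_basis C N)"

definition algebraic_extension :: "'a::ring_1 set \<Rightarrow> 'a set \<Rightarrow> bool" where
  "algebraic_extension M N \<longleftrightarrow>
     right_ideal M \<and> right_ideal N \<and> M \<subseteq> N \<and> (\<nexists>L. free_factor L N \<and> M \<subseteq> L \<and> L \<subset> N)"

subsection \<open>The dual of a right ideal with respect to the matrix \<open>(q)\<close>\<close>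

text \<open>
  The basis of the finitely generated free factor is given as a finite set \<open>B\<close>, and the
  coefficients of \<open>q\<close> are indexed by the elements of \<open>B\<close>. The resulting left ideal does not
  depend on the choices when \<open>I\<close> is a right ideal of \<open>K[F]\<close> containing \<open>q\<close>.
\<close>

definition is_Q_dual :: "'a::ring_1 \<Rightarrow> 'a set \<Rightarrow> 'a set \<Rightarrow> bool" where
  "is_Q_dual q I J \<longleftrightarrow>
     (\<exists>I_fin B b. free_factor I_fin I \<and> q \<in> I_fin \<and> finite B \<and> right_basis B I_fin \<and>
        q = (\<Sum>f\<in>B. f * b f) \<and> J = left_span (b ` B))"

definition Q_dual :: "'a::ring_1 \<Rightarrow> 'a set \<Rightarrow> 'a set" where
  "Q_dual q I = (THE J. is_Q_dual q I J)"

subsection \<open>The inversion map of the group algebra\<close>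

definition iota :: "('f::group_add \<Rightarrow>\<^sub>0 'k::ring_1) \<Rightarrow> ('f \<Rightarrow>\<^sub>0 'k)" where
  "iota a = (\<Sum>u\<in>Poly_Mapping.keys a. Poly_Mapping.single (- u) (Poly_Mapping.lookup a u))"

end

theory Submission
  imports Defs
begin

text \<open>
  Write \<open>A = K[F]\<close> and \<open>q = w - 1\<close>. The key is that the algebraic extensions of \<open>q A\<close> are exactly
  the right ideals arising from factorizations \<open>q = f\<^sub>1 b\<^sub>1 + \<dots> + f\<^sub>n b\<^sub>n\<close> in which the \<open>f\<^sub>i\<close> are right
  independent and the \<open>b\<^sub>i\<close> are left independent: the ideal is the right span of the \<open>f\<^sub>i\<close>
  (\<open>algebraic_extension_factorization\<close>, \<open>factorization_algebraic_extension\<close>). Its dual is the left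
  span of the \<open>b\<^sub>i\<close>, so such a factorization is symmetric in an ideal and its dual, and the two have
  the same rank \<open>n\<close>. The inversion \<open>\<iota>\<close> is an anti-automorphism with \<open>\<iota>(q) = - q w\<^sup>-\<^sup>1\<close>; it turns the
  factorization into \<open>q = \<Sum> \<iota>(b\<^sub>i) (- \<iota>(f\<^sub>i) w)\<close>, which is of the same kind. Doing this twice
  replaces \<open>f\<^sub>i\<close> by \<open>- w\<^sup>-\<^sup>1 f\<^sub>i\<close>, and \<open>w\<^sup>-\<^sup>1 I = I\<close> because \<open>w - 1 \<in> I\<close>. Inclusions are reversed because
  the dual of \<open>I\<close> is the set of values \<open>\<phi>(q)\<close> of the linear functionals \<open>\<phi>\<close> on \<open>I\<close>
  (\<open>Q_dual_eq_functionals\<close>), and functionals restrict to smaller ideals.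

  The structure of \<open>A\<close> enters at two points. The first is that every right ideal has a basis
  (\<open>right_ideal_has_basis\<close>). The description of algebraic extensions follows from it: the kernel of a
  functional on a right ideal is a right ideal, hence free, and it is a free factor because the image is a right ideal too (\<open>free_factor_kernel\<close>). The basis is
  Lewin's: choose a subtree \<open>T\<close> of the Cayley tree of \<open>F\<close> that is a \<open>K\<close>-basis of \<open>A / I\<close>, and for each
  edge from \<open>t \<in> T\<close> to \<open>t x \<notin> T\<close> with \<open>x \<in> X\<close> take the difference of \<open>t x\<close> and its normal form modulo
  \<open>I\<close>. Fox derivatives separate these elements (\<open>generator_functional\<close>). For \<open>I = A\<close> there is no such
  subtree, and the basis is \<open>{1}\<close>. The second point is that the rank is well defined, which follows
  from the augmentation \<open>A \<rightarrow> K\<close> and linear algebra over \<open>K\<close> (\<open>right_free_length_le\<close>).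
\<close>

section \<open>Bases of right ideals over a ring\<close>

lemma right_spanI: "finite T \<Longrightarrow> T \<subseteq> B \<Longrightarrow> (\<Sum>f\<in>T. f * c f) \<in> right_span B"
  unfolding right_span_def by blast

lemma right_ideal_sum:
  assumes "right_ideal I" "\<And>x. x \<in> T \<Longrightarrow> g x \<in> I"
  shows "(\<Sum>x\<in>T. g x * c x) \<in> I"
  using assms(2)
  by (induction T rule: infinite_finite_induct) (use assms(1) in \<open>auto simp: right_ideal_def\<close>)

lemma right_ideal_uminus: "right_ideal I \<Longrightarrow> x \<in> I \<Longrightarrow> - x \<in> I"
  unfolding right_ideal_def by (metis mult_minus1_right)

lemma right_ideal_diff: "right_ideal I \<Longrightarrow> x \<in> I \<Longrightarrow> y \<in> I \<Longrightarrow> x - y \<in> I"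
  using right_ideal_uminus[of I y] unfolding right_ideal_def
  by (metis diff_conv_add_uminus)

lemma sum_extend_by_zero:
  fixes c :: "'b \<Rightarrow> 'a::semiring_0"
  assumes "finite S" "T \<subseteq> S"
  shows "(\<Sum>f\<in>S. h f * (if f \<in> T then c f else 0)) = (\<Sum>f\<in>T. h f * c f)"
proof -
  have "(\<Sum>f\<in>S. h f * (if f \<in> T then c f else 0)) = (\<Sum>f\<in>S. if f \<in> T then h f * c f else 0)"
    by (intro sum.cong) auto
  then show ?thesis
    using assms by (simp add: sum.inter_restrict[symmetric] Int_absorb1)
qed

lemma right_ideal_right_span: "right_ideal (right_span B)"
  unfolding right_ideal_def
proof (intro conjI ballI allI)
  show "0 \<in> right_span B"
    using right_spanI[of "{}"] by simp
next
  fix x y assume "x \<in> right_span B" "y \<in> right_span B"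
  then obtain S c T d where x: "finite S" "S \<subseteq> B" "x = (\<Sum>f\<in>S. f * c f)"
    and y: "finite T" "T \<subseteq> B" "y = (\<Sum>f\<in>T. f * d f)"
    unfolding right_span_def by blast
  have "x + y = (\<Sum>f\<in>S \<union> T. f * ((if f \<in> S then c f else 0) + (if f \<in> T then d f else 0)))"
    unfolding x y distrib_left sum.distrib using x y
    by (simp add: sum_extend_by_zero)
  then show "x + y \<in> right_span B"
    using x y right_spanI by (metis finite_UnI sup_least)
next
  fix x r assume "x \<in> right_span B"
  then obtain S c where x: "finite S" "S \<subseteq> B" "x = (\<Sum>f\<in>S. f * c f)"
    unfolding right_span_def by blast
  have "x * r = (\<Sum>f\<in>S. f * (c f * r))"
    unfolding x by (simp add: sum_distrib_right mult.assoc)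
  then show "x * r \<in> right_span B"
    using x right_spanI by metis
qed

lemma right_span_superset: "B \<subseteq> right_span B"
proof
  fix x assume "x \<in> B"
  then show "x \<in> right_span B"
    using right_spanI[of "{x}" B "\<lambda>_. 1"] by simp
qed

lemma right_span_least: "right_ideal I \<Longrightarrow> B \<subseteq> I \<Longrightarrow> right_span B \<subseteq> I"
  unfolding right_span_def using right_ideal_sum[of I _ "\<lambda>x. x"] by blast

lemma right_independentD:
  "right_independent B \<Longrightarrow> finite T \<Longrightarrow> T \<subseteq> B \<Longrightarrow> (\<Sum>f\<in>T. f * c f) = 0 \<Longrightarrow> f \<in> T \<Longrightarrow> c f = 0"
  unfolding right_independent_def by blast

lemma right_independent_mono: "right_independent C \<Longrightarrow> B \<subseteq> C \<Longrightarrow> right_independent B"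
  unfolding right_independent_def by (meson subset_trans)

lemma right_independent_nonzero:
  assumes "right_independent B" shows "0 \<notin> B"
proof
  assume "0 \<in> B"
  then have "(1::'a) = 0"
    using right_independentD[OF assms, of "{0}" "\<lambda>_. 1" 0] by simp
  then show False by simp
qed

lemma right_ideal_right_basis: "right_basis B I \<Longrightarrow> right_ideal I"
  unfolding right_basis_def using right_ideal_right_span by blast

lemma right_basis_subset: "right_basis B I \<Longrightarrow> B \<subseteq> I"
  unfolding right_basis_def using right_span_superset by blast

lemma free_factor_subset: "free_factor L I \<Longrightarrow> L \<subseteq> I"
  unfolding free_factor_def
  by (metis right_basis_def right_basis_subset right_ideal_right_basis right_span_least subset_trans)

lemma free_factor_span_subset:
  "right_basis C I \<Longrightarrow> B \<subseteq> C \<Longrightarrow> free_factor (right_span B) I"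
  unfolding free_factor_def right_basis_def using right_independent_mono by blast

subsection \<open>Linear functionals\<close>

definition right_linear_on :: "'a::ring_1 set \<Rightarrow> ('a \<Rightarrow> 'a) \<Rightarrow> bool" where
  "right_linear_on I \<phi> \<longleftrightarrow>
     (\<forall>x\<in>I. \<forall>y\<in>I. \<phi> (x + y) = \<phi> x + \<phi> y) \<and> (\<forall>x\<in>I. \<forall>r. \<phi> (x * r) = \<phi> x * r)"

lemma right_linear_on_subset: "right_linear_on J \<phi> \<Longrightarrow> I \<subseteq> J \<Longrightarrow> right_linear_on I \<phi>"
  unfolding right_linear_on_def by blast

lemma right_linear_on_sum:
  assumes "right_linear_on I \<phi>" "right_ideal I" "\<And>x. x \<in> T \<Longrightarrow> g x \<in> I"
  shows "\<phi> (\<Sum>x\<in>T. g x * c x) = (\<Sum>x\<in>T. \<phi> (g x) * c x)"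
proof -
  have zero: "\<phi> 0 = 0"
    using assms(1,2) unfolding right_linear_on_def right_ideal_def by (metis mult_zero_right)
  show ?thesis using assms(3)
  proof (induction T rule: infinite_finite_induct)
    case (insert x T)
    have "g x * c x \<in> I" "(\<Sum>x\<in>T. g x * c x) \<in> I"
      using insert assms(2) right_ideal_sum[of I T g c] by (auto simp: right_ideal_def)
    then show ?case
      using insert assms(1) by (simp add: right_linear_on_def)
  qed (simp_all add: zero)
qed

lemma right_linear_on_eqI:
  assumes "right_linear_on I \<phi>" "right_linear_on I \<psi>" "right_span B = I"
    and "\<And>f. f \<in> B \<Longrightarrow> \<phi> f = \<psi> f" and "x \<in> I"
  shows "\<phi> x = \<psi> x"
proof -
  obtain T c where x: "finite T" "T \<subseteq> B" "x = (\<Sum>f\<in>T. f * c f)"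
    using assms(3,5) unfolding right_span_def by blast
  have I: "right_ideal I" "B \<subseteq> I"
    using assms(3) right_ideal_right_span right_span_superset by blast+
  have "\<phi> x = (\<Sum>f\<in>T. \<phi> f * c f)" "\<psi> x = (\<Sum>f\<in>T. \<psi> f * c f)"
    unfolding x(3) using x I assms(1,2)
    by (auto intro!: right_linear_on_sum[where g = "\<lambda>x. x"])
  then show ?thesis using assms(4) x(2) by (auto intro!: sum.cong)
qed

text \<open>
  The universal property of a free module; only linearity on \<open>I\<close> is meant, the value of \<open>\<phi>\<close> outside
  \<open>I\<close> is a default. All later arguments about coordinates go through such functionals.
\<close>

lemma right_basis_functional:
  assumes "right_basis C I"
  obtains \<phi> where "right_linear_on I \<phi>" "\<And>f. f \<in> C \<Longrightarrow> \<phi> f = h f"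
proof -
  have ind: "right_independent C" and span: "right_span C = I"
    using assms by (auto simp: right_basis_def)
  \<comment> \<open>Two expansions of the same element have the same coefficients, once both are padded with
    zeros to the union of their supports.\<close>
  have unique: "(\<Sum>f\<in>S. h f * c f) = (\<Sum>f\<in>T. h f * d f)"
    if S: "finite S" "S \<subseteq> C" and T: "finite T" "T \<subseteq> C"
      and eq: "(\<Sum>f\<in>S. f * c f) = (\<Sum>f\<in>T. f * d f)" for S T c d
  proof -
    let ?c = "\<lambda>f. if f \<in> S then c f else 0" and ?d = "\<lambda>f. if f \<in> T then d f else 0"
    have "(\<Sum>f\<in>S \<union> T. f * (?c f - ?d f)) = 0"
      unfolding right_diff_distrib sum_subtractf using S T eq by (simp add: sum_extend_by_zero)
    then have "?c f - ?d f = 0" if "f \<in> S \<union> T" for f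
      using right_independentD[OF ind, of "S \<union> T" "\<lambda>f. ?c f - ?d f" f] S T that by simp
    then have "(\<Sum>f\<in>S \<union> T. h f * ?c f) = (\<Sum>f\<in>S \<union> T. h f * ?d f)"
      by (intro sum.cong) auto
    then show ?thesis using S T by (simp add: sum_extend_by_zero)
  qed
  have "\<exists>S c. finite S \<and> S \<subseteq> C \<and> x = (\<Sum>f\<in>S. f * c f)" if "x \<in> I" for x
    using that span unfolding right_span_def by blast
  then obtain S c where
    Sc: "\<And>x. x \<in> I \<Longrightarrow> finite (S x) \<and> S x \<subseteq> C \<and> x = (\<Sum>f\<in>S x. f * c x f)"
    by metis
  define \<phi> where "\<phi> x = (\<Sum>f\<in>S x. h f * c x f)" for x
  have eval: "\<phi> (\<Sum>f\<in>T. f * d f) = (\<Sum>f\<in>T. h f * d f)" if T: "finite T" "T \<subseteq> C" for T d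
  proof -
    have "(\<Sum>f\<in>T. f * d f) \<in> I"
      using T span right_spanI by blast
    then show ?thesis
      unfolding \<phi>_def using Sc[of "\<Sum>f\<in>T. f * d f"] T by (intro unique) auto
  qed
  show ?thesis
  proof
    show "right_linear_on I \<phi>"
      unfolding right_linear_on_def
    proof (intro conjI ballI allI)
      fix x y assume x: "x \<in> I" and y: "y \<in> I"
      let ?c = "\<lambda>f. if f \<in> S x then c x f else 0" and ?d = "\<lambda>f. if f \<in> S y then c y f else 0"
      have "x + y = (\<Sum>f\<in>S x \<union> S y. f * (?c f + ?d f))"
        unfolding distrib_left sum.distrib using Sc[OF x] Sc[OF y] by (simp add: sum_extend_by_zero)
      then have "\<phi> (x + y) = (\<Sum>f\<in>S x \<union> S y. h f * (?c f + ?d f))"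
        using eval[of "S x \<union> S y" "\<lambda>f. ?c f + ?d f"] Sc[OF x] Sc[OF y] by simp
      then show "\<phi> (x + y) = \<phi> x + \<phi> y"
        unfolding distrib_left sum.distrib using Sc[OF x] Sc[OF y]
        by (simp add: sum_extend_by_zero \<phi>_def)
    next
      fix x r assume x: "x \<in> I"
      have "x * r = (\<Sum>f\<in>S x. f * (c x f * r))"
        using Sc[OF x] by (metis (no_types, lifting) mult.assoc sum.cong sum_distrib_right)
      then have "\<phi> (x * r) = (\<Sum>f\<in>S x. h f * (c x f * r))"
        using eval[of "S x" "\<lambda>f. c x f * r"] Sc[OF x] by simp
      then show "\<phi> (x * r) = \<phi> x * r"
        by (simp add: \<phi>_def sum_distrib_right mult.assoc)
    qed
    show "\<phi> f = h f" if "f \<in> C" for f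
      using eval[of "{f}" "\<lambda>_. 1"] that by simp
  qed
qed

subsection \<open>Finite families\<close>

definition right_free :: "(nat \<Rightarrow> 'a::ring_1) \<Rightarrow> nat \<Rightarrow> bool" where
  "right_free f n \<longleftrightarrow> (\<forall>c. (\<Sum>i<n. f i * c i) = 0 \<longrightarrow> (\<forall>i<n. c i = 0))"

definition left_free :: "(nat \<Rightarrow> 'a::ring_1) \<Rightarrow> nat \<Rightarrow> bool" where
  "left_free b n \<longleftrightarrow> (\<forall>a. (\<Sum>i<n. a i * b i) = 0 \<longrightarrow> (\<forall>i<n. a i = 0))"

definition right_comb :: "(nat \<Rightarrow> 'a::ring_1) \<Rightarrow> nat \<Rightarrow> 'a set" where
  "right_comb f n = range (\<lambda>c. \<Sum>i<n. f i * c i)"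

definition left_comb :: "(nat \<Rightarrow> 'a::ring_1) \<Rightarrow> nat \<Rightarrow> 'a set" where
  "left_comb b n = range (\<lambda>a. \<Sum>i<n. a i * b i)"

lemma right_freeD: "right_free f n \<Longrightarrow> (\<Sum>i<n. f i * c i) = 0 \<Longrightarrow> i < n \<Longrightarrow> c i = 0"
  unfolding right_free_def by blast

lemma left_freeD: "left_free b n \<Longrightarrow> (\<Sum>i<n. a i * b i) = 0 \<Longrightarrow> i < n \<Longrightarrow> a i = 0"
  unfolding left_free_def by blast

lemma inj_on_right_free:
  assumes "right_free f n" shows "inj_on f {..<n}"
proof (rule inj_onI, rule ccontr)
  fix i j assume ij: "i \<in> {..<n}" "j \<in> {..<n}" "f i = f j" "i \<noteq> j"
  let ?c = "\<lambda>k. if k = i then 1 else if k = j then -1 else 0 :: 'a"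
  have "(\<Sum>k<n. f k * ?c k) = (\<Sum>k\<in>{i, j}. f k * ?c k)"
    using ij by (intro sum.mono_neutral_right) auto
  also have "\<dots> = 0" using ij by simp
  finally have "?c i = 0"
    using right_freeD[OF assms, of ?c i] ij by simp
  then show False by simp
qed

lemma right_basis_right_free:
  assumes "right_free f n" shows "right_basis (f ` {..<n}) (right_comb f n)"
proof -
  have inj: "inj_on f {..<n}" by (rule inj_on_right_free[OF assms])
  have "right_independent (f ` {..<n})"
    unfolding right_independent_def
  proof (intro allI impI, elim conjE)
    fix T c assume T: "finite T" "T \<subseteq> f ` {..<n}" "(\<Sum>f\<in>T. f * c f) = 0"
    let ?c = "\<lambda>x. if x \<in> T then c x else 0"
    have "(\<Sum>i<n. f i * ?c (f i)) = (\<Sum>x\<in>f ` {..<n}. x * ?c x)"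
      using inj by (simp add: sum.reindex)
    also have "\<dots> = 0" using T by (simp add: sum_extend_by_zero)
    finally have "\<forall>i<n. ?c (f i) = 0"
      using right_freeD[OF assms, of "\<lambda>i. ?c (f i)"] by blast
    then show "\<forall>f\<in>T. c f = 0"
      using T(2) by fastforce
  qed
  moreover have "right_span (f ` {..<n}) = right_comb f n"
  proof
    show "right_comb f n \<subseteq> right_span (f ` {..<n})"
      unfolding right_comb_def
      using right_ideal_sum[OF right_ideal_right_span, of "{..<n}" f] right_span_superset[of "f ` {..<n}"]
      by blast
    show "right_span (f ` {..<n}) \<subseteq> right_comb f n"
    proof
      fix x assume "x \<in> right_span (f ` {..<n})"
      then obtain T c where T: "finite T" "T \<subseteq> f ` {..<n}" "x = (\<Sum>f\<in>T. f * c f)"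
        unfolding right_span_def by blast
      let ?c = "\<lambda>x. if x \<in> T then c x else 0"
      have "x = (\<Sum>x\<in>f ` {..<n}. x * ?c x)" using T by (simp add: sum_extend_by_zero)
      also have "\<dots> = (\<Sum>i<n. f i * ?c (f i))"
        using inj by (simp add: sum.reindex)
      finally show "x \<in> right_comb f n" unfolding right_comb_def by auto
    qed
  qed
  ultimately show ?thesis by (simp add: right_basis_def)
qed

lemma right_free_of_right_basis:
  assumes "right_basis B I" "finite B"
  obtains f where "right_free f (card B)" "B = f ` {..<card B}" "I = right_comb f (card B)"
proof -
  obtain f where f: "bij_betw f {..<card B} B"
    using ex_bij_betw_nat_finite[OF assms(2)] by (auto simp: atLeast0LessThan)
  then have B: "B = f ` {..<card B}" and inj: "inj_on f {..<card B}"
    by (auto simp: bij_betw_def)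
  have "right_free f (card B)"
    unfolding right_free_def
  proof (intro allI impI)
    fix c i assume c: "(\<Sum>i<card B. f i * c i) = 0" "i < card B"
    let ?g = "inv_into {..<card B} f"
    have "(\<Sum>x\<in>f ` {..<card B}. x * c (?g x)) = (\<Sum>i<card B. f i * c i)"
      using inj by (simp add: sum.reindex)
    then have "(\<Sum>x\<in>B. x * c (?g x)) = 0"
      using c B by simp
    then have "c (?g (f i)) = 0"
      using right_independentD[of B B "\<lambda>x. c (?g x)" "f i"] assms c(2) B
      by (auto simp: right_basis_def)
    then show "c i = 0" using inj c(2) by simp
  qed
  moreover from right_basis_right_free[OF this] have "I = right_comb f (card B)"
    using assms(1) unfolding right_basis_def B[symmetric] by simp
  ultimately show ?thesis using B that by blast
qed

text \<open>
  The map \<open>b\<close> need not be injective, so coefficients of equal elements have to be merged.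
\<close>

lemma left_span_image:
  assumes "finite B"
  shows "left_span (b ` B) = range (\<lambda>a. \<Sum>f\<in>B. a f * b f)"
proof
  show "left_span (b ` B) \<subseteq> range (\<lambda>a. \<Sum>f\<in>B. a f * b f)"
  proof
    fix x assume "x \<in> left_span (b ` B)"
    then obtain T c where T: "finite T" "T \<subseteq> b ` B" "x = (\<Sum>g\<in>T. c g * g)"
      unfolding left_span_def by blast
    obtain S where S: "S \<subseteq> B" "inj_on b S" "T = b ` S"
      using T(2) by (meson subset_image_inj)
    have "x = (\<Sum>f\<in>S. c (b f) * b f)"
      using T(3) S by (simp add: sum.reindex)
    also have "\<dots> = (\<Sum>f\<in>B. if f \<in> S then c (b f) * b f else 0)"
      using assms S(1) by (simp add: sum.inter_restrict[symmetric] Int_absorb1)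
    also have "\<dots> = (\<Sum>f\<in>B. (if f \<in> S then c (b f) else 0) * b f)"
      by (intro sum.cong) auto
    finally show "x \<in> range (\<lambda>a. \<Sum>f\<in>B. a f * b f)" by auto
  qed
  show "range (\<lambda>a. \<Sum>f\<in>B. a f * b f) \<subseteq> left_span (b ` B)"
  proof
    fix x assume "x \<in> range (\<lambda>a. \<Sum>f\<in>B. a f * b f)"
    then obtain a where "x = (\<Sum>f\<in>B. a f * b f)" by auto
    also have "\<dots> = (\<Sum>g\<in>b ` B. \<Sum>f\<in>{f \<in> B. b f = g}. a f * b f)"
      using sum.image_gen[OF assms] by blast
    also have "\<dots> = (\<Sum>g\<in>b ` B. (\<Sum>f\<in>{f \<in> B. b f = g}. a f) * g)"
      by (intro sum.cong) (auto simp: sum_distrib_right)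
    finally show "x \<in> left_span (b ` B)"
      unfolding left_span_def using assms
      by (intro CollectI exI[of _ "b ` B"] exI[of _ "\<lambda>g. \<Sum>f\<in>{f \<in> B. b f = g}. a f"]) simp
  qed
qed

section \<open>The dual ideal through linear functionals\<close>

text \<open>
  If \<open>q = \<Sum> f\<^sub>i b\<^sub>i\<close> then a functional \<open>\<phi>\<close> sends \<open>q\<close> to \<open>\<Sum> \<phi>(f\<^sub>i) b\<^sub>i\<close>, and the values \<open>\<phi>(f\<^sub>i)\<close> can be
  prescribed because the \<open>f\<^sub>i\<close> are a basis of a free factor, from which functionals extend to all
  of \<open>I\<close>. So the left ideal generated by the \<open>b\<^sub>i\<close> is the set of values at \<open>q\<close>. This description
  mentions neither the free factor nor its basis, hence proves independence of the choices.
\<close>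

lemma Q_dual_eq_functionals:
  assumes C: "right_basis C I" and q: "q \<in> I"
  shows "Q_dual q I = {\<phi> q |\<phi>. right_linear_on I \<phi>}"
proof -
  have eq: "J = {\<phi> q |\<phi>. right_linear_on I \<phi>}" if J: "is_Q_dual q I J" for J
  proof -
    obtain L B b where L: "free_factor L I" "q \<in> L" "finite B" "right_basis B L"
      "q = (\<Sum>f\<in>B. f * b f)" "J = left_span (b ` B)"
      using J unfolding is_Q_dual_def by blast
    obtain B0 C0 where B0: "right_basis B0 L" "B0 \<subseteq> C0" "right_basis C0 I"
      using L(1) unfolding free_factor_def by blast
    have LI: "L \<subseteq> I" using L(1) by (rule free_factor_subset)
    have val: "\<phi> q = (\<Sum>f\<in>B. \<phi> f * b f)" if "right_linear_on I \<phi>" for \<phi>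
      unfolding L(5) using right_basis_subset[OF L(4)] LI
      by (intro right_linear_on_sum[OF that right_ideal_right_basis[OF C]]) auto
    have J_eq: "J = range (\<lambda>a. \<Sum>f\<in>B. a f * b f)"
      using L left_span_image by blast
    show ?thesis
    proof
      show "{\<phi> q |\<phi>. right_linear_on I \<phi>} \<subseteq> J"
        unfolding J_eq using val by auto
      show "J \<subseteq> {\<phi> q |\<phi>. right_linear_on I \<phi>}"
      proof
        fix x assume "x \<in> J"
        then obtain a where a: "x = (\<Sum>f\<in>B. a f * b f)" unfolding J_eq by auto
        obtain \<psi> where \<psi>: "right_linear_on L \<psi>" "\<And>f. f \<in> B \<Longrightarrow> \<psi> f = a f"
          using right_basis_functional[OF L(4), of a] by blast
        obtain \<phi> where \<phi>: "right_linear_on I \<phi>" "\<And>f. f \<in> C0 \<Longrightarrow> \<phi> f = \<psi> f"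
          using right_basis_functional[OF B0(3), of \<psi>] by blast
        have "\<phi> f = a f" if "f \<in> B" for f
        proof -
          have "\<phi> f = \<psi> f"
          proof (rule right_linear_on_eqI[where I = L and B = B0 and \<phi> = \<phi> and \<psi> = \<psi> and x = f])
            show "right_linear_on L \<phi>" using \<phi>(1) LI by (rule right_linear_on_subset)
            show "right_span B0 = L" using B0(1) by (simp add: right_basis_def)
            show "f \<in> L" using that right_basis_subset[OF L(4)] by blast
          qed (use \<psi>(1) \<phi>(2) B0(2) in auto)
          then show ?thesis using \<psi>(2) that by simp
        qed
        then have "x = \<phi> q" using val[OF \<phi>(1)] a by simp
        then show "x \<in> {\<phi> q |\<phi>. right_linear_on I \<phi>}" using \<phi>(1) by blast
      qed
    qed
  qed
  have "\<exists>J. is_Q_dual q I J"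
  proof -
    obtain T c where T: "finite T" "T \<subseteq> C" "q = (\<Sum>f\<in>T. f * c f)"
      using C q unfolding right_basis_def right_span_def by blast
    have "free_factor (right_span T) I" using C T(2) by (rule free_factor_span_subset)
    moreover have "q \<in> right_span T" using T right_spanI[of T T] by simp
    moreover have "right_basis T (right_span T)"
      using C T(2) right_independent_mono unfolding right_basis_def by blast
    ultimately show ?thesis unfolding is_Q_dual_def using T by blast
  qed
  then obtain J where J: "is_Q_dual q I J" ..
  then have "Q_dual q I = J"
    unfolding Q_dual_def using eq by (intro the_equality) auto
  then show ?thesis using eq[OF J] by simp
qed

text \<open>
  Enlarging the ideal leaves fewer functionals: those on \<open>J\<close> restrict to \<open>I\<close>.
\<close>

lemma Q_dual_antimono:
  assumes "right_basis B I" "right_basis C J" "q \<in> I" "I \<subseteq> J"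
  shows "Q_dual q J \<subseteq> Q_dual q I"
  using assms right_linear_on_subset[OF _ assms(4)]
  by (auto simp: Q_dual_eq_functionals subsetD)

lemma Q_dual_right_comb:
  assumes "right_free f n"
  shows "Q_dual (\<Sum>i<n. f i * b i) (right_comb f n) = left_comb b n"
proof -
  let ?q = "\<Sum>i<n. f i * b i"
  have basis: "right_basis (f ` {..<n}) (right_comb f n)"
    using assms by (rule right_basis_right_free)
  have q: "?q \<in> right_comb f n" by (auto simp: right_comb_def)
  have val: "\<phi> ?q = (\<Sum>i<n. \<phi> (f i) * b i)" if "right_linear_on (right_comb f n) \<phi>" for \<phi>
    using right_basis_subset[OF basis]
    by (intro right_linear_on_sum[OF that right_ideal_right_basis[OF basis]]) auto
  have "{\<phi> ?q |\<phi>. right_linear_on (right_comb f n) \<phi>} = left_comb b n"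
  proof
    show "{\<phi> ?q |\<phi>. right_linear_on (right_comb f n) \<phi>} \<subseteq> left_comb b n"
      by (force simp: left_comb_def val)
    show "left_comb b n \<subseteq> {\<phi> ?q |\<phi>. right_linear_on (right_comb f n) \<phi>}"
    proof
      fix x assume "x \<in> left_comb b n"
      then obtain a where a: "x = (\<Sum>i<n. a i * b i)" by (auto simp: left_comb_def)
      obtain \<phi> where \<phi>: "right_linear_on (right_comb f n) \<phi>"
        "\<And>g. g \<in> f ` {..<n} \<Longrightarrow> \<phi> g = a (inv_into {..<n} f g)"
        using right_basis_functional[OF basis, where h = "\<lambda>g. a (inv_into {..<n} f g)"] by blast
      have "x = \<phi> ?q"
        unfolding a val[OF \<phi>(1)] using \<phi>(2) inj_on_right_free[OF assms]
        by (intro sum.cong) auto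
      then show "x \<in> {\<phi> ?q |\<phi>. right_linear_on (right_comb f n) \<phi>}" using \<phi>(1) by blast
    qed
  qed
  then show ?thesis using Q_dual_eq_functionals[OF basis q] by simp
qed

section \<open>Algebraic extensions as factorizations\<close>

text \<open>
  The kernel and the image of a functional on a right ideal of the ring are again right ideals of
  the ring, so both are free when every right ideal is. The extension \<open>ker \<phi> \<rightarrow> I \<rightarrow> \<phi>(I)\<close> then
  splits, and a basis of the kernel together with lifts of a basis of the image is a basis of \<open>I\<close>.
\<close>

lemma free_factor_kernel:
  assumes fir: "\<And>J :: 'a::ring_1 set. right_ideal J \<Longrightarrow> \<exists>B. right_basis B J"
    and I: "right_ideal I" and lin: "right_linear_on I \<phi>"
  shows "free_factor {x \<in> I. \<phi> x = (0::'a)} I"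
proof -
  have ker: "right_ideal {x \<in> I. \<phi> x = 0}"
    unfolding right_ideal_def
  proof (intro conjI ballI allI)
    show "0 \<in> {x \<in> I. \<phi> x = 0}"
      using I right_linear_on_sum[OF lin I, of "{}"] by (simp add: right_ideal_def)
  qed (use I lin in \<open>auto simp: right_ideal_def right_linear_on_def\<close>)
  have img: "right_ideal (\<phi> ` I)"
    unfolding right_ideal_def
  proof (intro conjI ballI allI)
    show "0 \<in> \<phi> ` I"
      using I right_linear_on_sum[OF lin I, of "{}"] by (force simp: right_ideal_def)
  next
    fix x y assume "x \<in> \<phi> ` I" "y \<in> \<phi> ` I"
    then obtain u v where "u \<in> I" "v \<in> I" "x = \<phi> u" "y = \<phi> v" by blast
    then have "u + v \<in> I" "x + y = \<phi> (u + v)"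
      using I lin by (auto simp: right_ideal_def right_linear_on_def)
    then show "x + y \<in> \<phi> ` I" by blast
  next
    fix x r assume "x \<in> \<phi> ` I"
    then obtain u where "u \<in> I" "x = \<phi> u" by blast
    then have "u * r \<in> I" "x * r = \<phi> (u * r)"
      using I lin by (auto simp: right_ideal_def right_linear_on_def)
    then show "x * r \<in> \<phi> ` I" by blast
  qed
  obtain B where B: "right_basis B {x \<in> I. \<phi> x = 0}" using fir[OF ker] by blast
  obtain D where D: "right_basis D (\<phi> ` I)" using fir[OF img] by blast
  have "\<forall>d\<in>D. \<exists>s. s \<in> I \<and> \<phi> s = d"
    using right_basis_subset[OF D] by fastforce
  then obtain s where s: "\<And>d. d \<in> D \<Longrightarrow> s d \<in> I \<and> \<phi> (s d) = d" by metis
  have inj: "inj_on s D" using s by (metis inj_onI)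
  have BI: "f \<in> I \<and> \<phi> f = 0" if "f \<in> B" for f
    using that right_basis_subset[OF B] by blast
  have disj: "B \<inter> s ` D = {}"
    using BI s right_independent_nonzero[of D] D unfolding right_basis_def by fastforce
  have "right_independent (B \<union> s ` D)"
    unfolding right_independent_def
  proof (intro allI impI, elim conjE)
    fix T c assume T: "finite T" "T \<subseteq> B \<union> s ` D" and zero: "(\<Sum>f\<in>T. f * c f) = 0"
    define E where "E = {d \<in> D. s d \<in> T}"
    have sE: "s ` E = T - B" and inE: "inj_on s E"
      using T disj inj by (auto simp: E_def inj_on_def)
    have finE: "finite E" using sE inE T(1) by (metis finite_Diff finite_imageD)
    have split: "(\<Sum>f\<in>T. f * c f) = (\<Sum>f\<in>T \<inter> B. f * c f) + (\<Sum>d\<in>E. s d * c (s d))"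
    proof -
      have "(\<Sum>f\<in>T. f * c f) = (\<Sum>f\<in>T \<inter> B. f * c f) + (\<Sum>f\<in>T - B. f * c f)"
        by (rule sum.Int_Diff[OF T(1)])
      then show ?thesis using inE by (simp add: sE[symmetric] sum.reindex)
    qed
    \<comment> \<open>Applying \<open>\<phi>\<close> removes the part in \<open>B\<close> and leaves a relation in the basis \<open>D\<close> of the image.\<close>
    have "\<phi> (\<Sum>f\<in>T. f * c f) = (\<Sum>f\<in>T. \<phi> f * c f)"
      using T(2) BI s by (intro right_linear_on_sum[OF lin I]) blast
    also have "\<dots> = (\<Sum>f\<in>T - B. \<phi> f * c f)"
      using T(1) BI by (intro sum.mono_neutral_right) auto
    also have "\<dots> = (\<Sum>d\<in>E. \<phi> (s d) * c (s d))"
      using inE by (simp add: sE[symmetric] sum.reindex)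
    also have "\<dots> = (\<Sum>d\<in>E. d * c (s d))"
      using s by (intro sum.cong) (auto simp: E_def)
    finally have "(\<Sum>d\<in>E. d * c (s d)) = 0"
      using zero right_linear_on_sum[OF lin I, of "{}"] by simp
    then have cE: "c (s d) = 0" if "d \<in> E" for d
      using right_independentD[of D E "\<lambda>d. c (s d)" d] D finE that
      by (auto simp: right_basis_def E_def)
    then have "(\<Sum>f\<in>T \<inter> B. f * c f) = 0"
      using split zero by simp
    then have "c f = 0" if "f \<in> T \<inter> B" for f
      using right_independentD[of B "T \<inter> B" c f] B T(1) that by (auto simp: right_basis_def)
    moreover have "c f = 0" if "f \<in> T - B" for f
      using cE that unfolding sE[symmetric] by auto
    ultimately show "\<forall>f\<in>T. c f = 0" by auto
  qed
  moreover have "right_span (B \<union> s ` D) = I"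
  proof
    show "right_span (B \<union> s ` D) \<subseteq> I"
      using I BI s by (intro right_span_least) auto
    show "I \<subseteq> right_span (B \<union> s ` D)"
    proof
      fix x assume x: "x \<in> I"
      then have "\<phi> x \<in> right_span D" using D by (simp add: right_basis_def)
      then obtain E c where E: "finite E" "E \<subseteq> D" "\<phi> x = (\<Sum>d\<in>E. d * c d)"
        unfolding right_span_def by blast
      define y where "y = (\<Sum>d\<in>E. s d * c d)"
      have y: "y \<in> I" unfolding y_def using E s by (intro right_ideal_sum[OF I]) blast
      have "\<phi> y = (\<Sum>d\<in>E. \<phi> (s d) * c d)"
        unfolding y_def using E s by (intro right_linear_on_sum[OF lin I]) blast
      also have "\<dots> = \<phi> x" unfolding E(3) using E(2) s by (intro sum.cong) auto
      finally have "\<phi> y = \<phi> x" .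
      moreover have "x - y \<in> I" using right_ideal_diff[OF I x y] .
      moreover have "\<phi> (x - y + y) = \<phi> (x - y) + \<phi> y"
        using lin \<open>x - y \<in> I\<close> y unfolding right_linear_on_def by blast
      ultimately have "x - y \<in> {x \<in> I. \<phi> x = 0}" by simp
      then have "x - y \<in> right_span B" using B by (simp add: right_basis_def)
      also have "right_span B \<subseteq> right_span (B \<union> s ` D)"
        using right_span_superset[of "B \<union> s ` D"]
        by (intro right_span_least right_ideal_right_span) blast
      finally have "x - y \<in> right_span (B \<union> s ` D)" .
      moreover have "y \<in> right_span (B \<union> s ` D)"
      proof -
        have "s d \<in> right_span (B \<union> s ` D)" if "d \<in> E" for d
          using E(2) that right_span_superset[of "B \<union> s ` D"] by blast
        then show ?thesis
          unfolding y_def by (intro right_ideal_sum[OF right_ideal_right_span])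
      qed
      ultimately have "x - y + y \<in> right_span (B \<union> s ` D)"
        using right_ideal_right_span[of "B \<union> s ` D"] unfolding right_ideal_def by blast
      then show "x \<in> right_span (B \<union> s ` D)" by simp
    qed
  qed
  ultimately have "right_basis (B \<union> s ` D) I" by (simp add: right_basis_def)
  then show ?thesis unfolding free_factor_def using B by blast
qed

text \<open>
  A left relation \<open>\<Sum> a\<^sub>i b\<^sub>i = 0\<close> says that the functional with \<open>\<phi>(f\<^sub>i) = a\<^sub>i\<close> vanishes at \<open>q\<close>. If it is
  nontrivial, the kernel of \<open>\<phi>\<close> is a proper free factor of \<open>I\<close> containing \<open>q\<close>, which an algebraic
  extension does not have. Finite generation has the same source: \<open>q\<close> involves finitely many
  elements of a basis, and these already span a free factor.
\<close>

lemma algebraic_extension_factorization: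
  fixes q :: "'a::ring_1"
  assumes fir: "\<And>J :: 'a set. right_ideal J \<Longrightarrow> \<exists>B. right_basis B J"
    and alg: "algebraic_extension (right_span {q}) I"
  obtains f b n where "right_free f n" "left_free b n" "q = (\<Sum>i<n. f i * b i)" "I = right_comb f n"
proof -
  have I: "right_ideal I" and q: "q \<in> I"
    using alg right_span_superset[of "{q}"] unfolding algebraic_extension_def by auto
  have minimal: "L = I" if L: "free_factor L I" "q \<in> L" for L
  proof -
    have "right_ideal L" using L(1) right_ideal_right_basis unfolding free_factor_def by blast
    then have "right_span {q} \<subseteq> L" using L(2) by (intro right_span_least) auto
    then show ?thesis
      using alg L(1) free_factor_subset[OF L(1)] unfolding algebraic_extension_def by blast
  qed
  obtain C where C: "right_basis C I" using fir[OF I] by blast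
  obtain B c where B: "finite B" "B \<subseteq> C" "q = (\<Sum>f\<in>B. f * c f)"
    using C q unfolding right_basis_def right_span_def by blast
  have "right_span B = I"
    using B right_spanI[of B B c] by (intro minimal free_factor_span_subset[OF C]) auto
  then have "right_basis B I"
    using C B(2) right_independent_mono unfolding right_basis_def by blast
  then obtain f n where f: "right_free f n" "I = right_comb f n"
    using right_free_of_right_basis B(1) by metis
  then obtain b where b: "q = (\<Sum>i<n. f i * b i)"
    using q unfolding right_comb_def by blast
  have "left_free b n"
    unfolding left_free_def
  proof (intro allI impI)
    fix a i assume a: "(\<Sum>i<n. a i * b i) = 0" and i: "i < n"
    have basis: "right_basis (f ` {..<n}) I"
      unfolding f(2) by (rule right_basis_right_free[OF f(1)])
    obtain \<phi> where \<phi>: "right_linear_on I \<phi>"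
      "\<And>g. g \<in> f ` {..<n} \<Longrightarrow> \<phi> g = a (inv_into {..<n} f g)"
      using right_basis_functional[OF basis, where h = "\<lambda>g. a (inv_into {..<n} f g)"] by blast
    have \<phi>f: "\<phi> (f j) = a j" if "j < n" for j
      using \<phi>(2) inj_on_right_free[OF f(1)] that by auto
    have "\<phi> q = (\<Sum>i<n. \<phi> (f i) * b i)"
      unfolding b using right_basis_subset[OF basis] by (intro right_linear_on_sum[OF \<phi>(1) I]) auto
    then have "\<phi> q = 0" using a \<phi>f by simp
    then have "{x \<in> I. \<phi> x = 0} = I"
      using q by (intro minimal free_factor_kernel[OF fir I \<phi>(1)]) auto
    then have "\<phi> (f i) = 0" using right_basis_subset[OF basis] i by blast
    then show "a i = 0" using \<phi>f i by simp
  qed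
  then show ?thesis using that f b by blast
qed

text \<open>
  Conversely, a proper free factor \<open>L\<close> containing \<open>q\<close> omits an element of some basis of \<open>I\<close>, and the
  coordinate of that element is a functional \<open>\<phi> \<noteq> 0\<close> with \<open>\<phi>(q) = 0\<close>; its values on the \<open>f\<^sub>i\<close> are the
  coefficients of a nontrivial relation between the \<open>b\<^sub>i\<close>.
\<close>

lemma factorization_algebraic_extension:
  fixes q :: "'a::ring_1"
  assumes f: "right_free f n" and b: "left_free b n" and q: "q = (\<Sum>i<n. f i * b i)"
  shows "algebraic_extension (right_span {q}) (right_comb f n)"
proof -
  let ?I = "right_comb f n"
  have basis: "right_basis (f ` {..<n}) ?I" by (rule right_basis_right_free[OF f])
  have I: "right_ideal ?I" by (rule right_ideal_right_basis[OF basis])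
  have "q \<in> ?I" unfolding right_comb_def q by blast
  moreover have "L = ?I" if L: "free_factor L ?I" and qL: "q \<in> L" for L
  proof -
    obtain B C where BC: "right_basis B L" "B \<subseteq> C" "right_basis C ?I"
      using L unfolding free_factor_def by blast
    have "C \<subseteq> B"
    proof
      fix g assume g: "g \<in> C"
      show "g \<in> B"
      proof (rule ccontr)
        assume "g \<notin> B"
        obtain \<phi> where \<phi>: "right_linear_on ?I \<phi>" "\<And>h. h \<in> C \<Longrightarrow> \<phi> h = (if h = g then 1 else 0)"
          using right_basis_functional[OF BC(3), where h = "\<lambda>h. if h = g then 1 else 0"] by blast
        have zero: "right_linear_on J (\<lambda>_. 0)" for J :: "'a set"
          by (simp add: right_linear_on_def)
        have "\<phi> q = 0"
        proof (rule right_linear_on_eqI[where I = L and B = B and \<phi> = \<phi> and \<psi> = "\<lambda>_. 0" and x = q])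
          show "right_linear_on L \<phi>"
            using \<phi>(1) free_factor_subset[OF L] by (rule right_linear_on_subset)
          show "right_span B = L" using BC(1) by (simp add: right_basis_def)
        qed (use qL \<phi>(2) BC(2) zero \<open>g \<notin> B\<close> in auto)
        moreover have "\<phi> q = (\<Sum>i<n. \<phi> (f i) * b i)"
          unfolding q using right_basis_subset[OF basis] by (intro right_linear_on_sum[OF \<phi>(1) I]) auto
        ultimately have "\<forall>i<n. \<phi> (f i) = 0" using b unfolding left_free_def by metis
        then have "\<phi> g = 0"
          using basis g right_basis_subset[OF BC(3)]
          by (intro right_linear_on_eqI[OF \<phi>(1) zero, where B = "f ` {..<n}" and x = g])
            (auto simp: right_basis_def)
        then show False using \<phi>(2)[OF g] by simp
      qed
    qed
    then have "B = C" using BC(2) by blast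
    then show ?thesis using BC by (simp add: right_basis_def)
  qed
  ultimately show ?thesis
    unfolding algebraic_extension_def
    using I right_ideal_right_span right_span_least[OF I, of "{q}"] right_span_superset[of "{q}"] by blast
qed

section \<open>The Cayley tree of a free group\<close>

locale free_group =
  fixes X :: "'f::group_add set"
  assumes basis: "free_group_basis X"
begin

definition normal_form :: "'f \<Rightarrow> ('f \<times> bool) list" where
  "normal_form g = (THE ws. ws \<in> lists (X \<times> UNIV) \<and> reduced_word ws \<and> word_value ws = g)"

lemma normal_form:
  "normal_form g \<in> lists (X \<times> UNIV)" "reduced_word (normal_form g)" "word_value (normal_form g) = g"
proof -
  have "\<exists>!ws. ws \<in> lists (X \<times> UNIV) \<and> reduced_word ws \<and> word_value ws = g"
    using basis unfolding free_group_basis_def by blast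
  from theI'[OF this] show "normal_form g \<in> lists (X \<times> UNIV)" "reduced_word (normal_form g)"
    "word_value (normal_form g) = g"
    unfolding normal_form_def by auto
qed

lemma normal_form_eqI:
  "ws \<in> lists (X \<times> UNIV) \<Longrightarrow> reduced_word ws \<Longrightarrow> word_value ws = g \<Longrightarrow> normal_form g = ws"
  using basis normal_form[of g] unfolding free_group_basis_def by metis

lemma normal_form_prefix:
  assumes "normal_form g = vs @ ws" shows "normal_form (word_value vs) = vs"
  using normal_form[of g] unfolding assms
  by (intro normal_form_eqI) (auto simp: reduced_word_def successively_append_iff)

text \<open>
  Multiplying by a generator moves along one edge of the Cayley tree: either the reduced word grows
  by \<open>x\<close>, or \<open>x\<close> cancels a final inverse letter.
\<close>

lemma normal_form_step:
  assumes "x \<in> X"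
  shows "normal_form (u + x) = normal_form u @ [(x, True)] \<or>
         normal_form u = normal_form (u + x) @ [(x, False)]"
proof (cases "\<exists>vs. normal_form u = vs @ [(x, False)]")
  case True
  then obtain vs where vs: "normal_form u = vs @ [(x, False)]" by blast
  then have "word_value vs = u + x"
    using normal_form(3)[of u] by (auto simp: word_value_def add.assoc)
  then show ?thesis
    using normal_form_prefix[OF vs] vs by simp
next
  case False
  have "normal_form (u + x) = normal_form u @ [(x, True)]"
  proof (rule normal_form_eqI)
    show "normal_form u @ [(x, True)] \<in> lists (X \<times> UNIV)"
      using normal_form(1)[of u] assms by simp
    have "last (normal_form u) \<noteq> (x, False)" if "normal_form u \<noteq> []"
      using False append_butlast_last_id[OF that] by metis
    then show "reduced_word (normal_form u @ [(x, True)])"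
      using normal_form(2)[of u]
      by (cases "normal_form u = []")
        (auto simp: reduced_word_def successively_append_iff split: prod.splits)
    show "word_value (normal_form u @ [(x, True)]) = u + x"
      using normal_form(3)[of u] by (simp add: word_value_def)
  qed
  then show ?thesis ..
qed

lemma normal_form_induct [case_names zero plus minus]:
  assumes "P 0"
    and "\<And>u x. x \<in> X \<Longrightarrow> P u \<Longrightarrow> normal_form (u + x) = normal_form u @ [(x, True)] \<Longrightarrow> P (u + x)"
    and "\<And>u x. x \<in> X \<Longrightarrow> P u \<Longrightarrow> normal_form (u - x) = normal_form u @ [(x, False)] \<Longrightarrow> P (u - x)"
  shows "P g"
proof -
  have "normal_form g = ws \<Longrightarrow> P g" for ws
  proof (induction ws arbitrary: g rule: rev_induct)
    case Nil
    then show ?case using assms(1) normal_form(3)[of g] by (simp add: word_value_def)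
  next
    case (snoc l ws)
    obtain x e where l: "l = (x, e)" by (cases l)
    define u where "u = word_value ws"
    have u: "normal_form u = ws"
      unfolding u_def using normal_form_prefix[OF snoc.prems] .
    have x: "x \<in> X" using normal_form(1)[of g] snoc.prems l by auto
    have "g = (if e then u + x else u - x)"
      using normal_form(3)[of g] unfolding snoc.prems u_def l by (cases e) (auto simp: word_value_def)
    then show ?case
      using assms(2,3)[OF x snoc.IH[OF u]] u snoc.prems l by (cases e) auto
  qed
  then show ?thesis by blast
qed

text \<open>
  Equivalently, \<open>T\<close> is nonempty and closed under taking prefixes of reduced words.
\<close>

definition subtree :: "'f set \<Rightarrow> bool" where
  "subtree T \<longleftrightarrow> 0 \<in> T \<and> (\<forall>u l g. g \<in> T \<and> normal_form g = normal_form u @ [l] \<longrightarrow> u \<in> T)"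

lemma subtree_insert:
  assumes T: "subtree T" and t: "t \<in> T" and x: "x \<in> X" and v: "v = t + x \<or> v = t - x"
  shows "subtree (insert v T)"
proof -
  have "\<exists>l. normal_form v = normal_form t @ [l] \<or> normal_form t = normal_form v @ [l]"
    using v normal_form_step[OF x, of t] normal_form_step[OF x, of v] by auto
  then consider l where "normal_form v = normal_form t @ [l]" | "v \<in> T"
    using T t unfolding subtree_def by blast
  then show ?thesis
  proof cases
    case 1
    have "u = t" if "normal_form v = normal_form u @ [l']" for u l'
      using that 1 normal_form(3) by (metis butlast_snoc)
    then show ?thesis using T t unfolding subtree_def by blast
  qed (use T in \<open>simp add: insert_absorb\<close>)
qed

end

section \<open>Linear maps on the group algebra\<close>

abbreviation scalar :: "'k \<Rightarrow> ('f::zero \<Rightarrow>\<^sub>0 'k::zero)" where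
  "scalar k \<equiv> Poly_Mapping.single 0 k"

abbreviation mon :: "'f \<Rightarrow> ('f \<Rightarrow>\<^sub>0 'k::{zero,one})" where
  "mon u \<equiv> Poly_Mapping.single u 1"

lemma group_algebra_expansion:
  fixes a :: "'f \<Rightarrow>\<^sub>0 'k::comm_monoid_add"
  shows "a = (\<Sum>u\<in>Poly_Mapping.keys a. Poly_Mapping.single u (Poly_Mapping.lookup a u))"
  by (intro poly_mapping_eqI)
    (auto simp: lookup_sum lookup_single when_def in_keys_iff sum.delta)

text \<open>
  Identities between additive maps on the group algebra need checking on single terms only.
\<close>

lemma group_algebra_induct [case_names single add]:
  fixes a :: "'f \<Rightarrow>\<^sub>0 'k::comm_monoid_add"
  assumes single: "\<And>u k. P (Poly_Mapping.single u k)"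
    and add: "\<And>a b. P a \<Longrightarrow> P b \<Longrightarrow> P (a + b)"
  shows "P a"
proof -
  have "P (\<Sum>u\<in>S. Poly_Mapping.single u (Poly_Mapping.lookup a u))" for S
    by (induction S rule: infinite_finite_induct) (use single[of undefined 0] single add in auto)
  then show ?thesis using group_algebra_expansion[of a] by metis
qed

lemma scalar_commute:
  fixes a :: "'f::monoid_add \<Rightarrow>\<^sub>0 'k::comm_semiring_1"
  shows "scalar k * a = a * scalar k"
  by (induction a rule: group_algebra_induct) (simp_all add: mult_single mult.commute distrib_left distrib_right)

lemma mon_mult: "mon u * mon v = (mon (u + v) :: 'f::monoid_add \<Rightarrow>\<^sub>0 'k::semiring_1)"
  by (simp add: mult_single)

definition linear_extension ::
    "('f \<Rightarrow> ('f::monoid_add \<Rightarrow>\<^sub>0 'k::comm_semiring_1)) \<Rightarrow> ('f \<Rightarrow>\<^sub>0 'k) \<Rightarrow> ('f \<Rightarrow>\<^sub>0 'k)" where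
  "linear_extension D a = (\<Sum>u\<in>Poly_Mapping.keys a. scalar (Poly_Mapping.lookup a u) * D u)"

lemma linear_extension_single [simp]: "linear_extension D (Poly_Mapping.single u k) = scalar k * D u"
  by (simp add: linear_extension_def)

lemma linear_extension_add:
  "linear_extension D (a + b) = linear_extension D a + linear_extension D b"
  unfolding linear_extension_def
  by (rule setsum_keys_plus_distrib) (simp_all add: single_add distrib_right)

section \<open>Schreier transversals and freeness of right ideals\<close>

text \<open>
  The sum \<open>K T + J\<close>: the elements that are congruent modulo \<open>J\<close> to a \<open>K\<close>-combination of elements
  of \<open>T\<close>.
\<close>

definition reducible :: "'f set \<Rightarrow> ('f::monoid_add \<Rightarrow>\<^sub>0 'k::comm_ring_1) set \<Rightarrow> ('f \<Rightarrow>\<^sub>0 'k) set" where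
  "reducible T J = {a. \<exists>c. Poly_Mapping.keys c \<subseteq> T \<and> a - c \<in> J}"

lemma keys_mult_scalar:
  fixes c :: "'f::monoid_add \<Rightarrow>\<^sub>0 'k::comm_semiring_1"
  shows "Poly_Mapping.keys (c * scalar k) \<subseteq> Poly_Mapping.keys c"
  using keys_mult[of c "scalar k"] by (auto split: if_splits)

lemma keys_diff_subset:
  fixes a b :: "'f \<Rightarrow>\<^sub>0 'k::ab_group_add"
  shows "Poly_Mapping.keys (a - b) \<subseteq> Poly_Mapping.keys a \<union> Poly_Mapping.keys b"
  by (auto simp: in_keys_iff lookup_minus)

lemma reducible_add:
  assumes "right_ideal J" "a \<in> reducible T J" "b \<in> reducible T J"
  shows "a + b \<in> reducible T J"
proof -
  obtain c d where "Poly_Mapping.keys c \<subseteq> T" "a - c \<in> J" "Poly_Mapping.keys d \<subseteq> T" "b - d \<in> J"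
    using assms unfolding reducible_def by blast
  then have "Poly_Mapping.keys (c + d) \<subseteq> T" "(a - c) + (b - d) \<in> J"
    using keys_add[of c d] assms(1) unfolding right_ideal_def by blast+
  then show ?thesis
    unfolding reducible_def by (auto simp: algebra_simps intro!: exI[of _ "c + d"])
qed

lemma reducible_scalar:
  fixes a :: "'f::monoid_add \<Rightarrow>\<^sub>0 'k::comm_ring_1"
  assumes "right_ideal J" "a \<in> reducible T J"
  shows "a * scalar k \<in> reducible T J"
proof -
  obtain c where c: "Poly_Mapping.keys c \<subseteq> T" "a - c \<in> J"
    using assms unfolding reducible_def by blast
  then have "Poly_Mapping.keys (c * scalar k) \<subseteq> T" "(a - c) * scalar k \<in> J"
    using keys_mult_scalar[of c k] assms(1) unfolding right_ideal_def by blast+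
  then show ?thesis
    unfolding reducible_def by (auto simp: algebra_simps intro!: exI[of _ "c * scalar k"])
qed

lemma reducible_support:
  fixes c :: "'f::monoid_add \<Rightarrow>\<^sub>0 'k::comm_ring_1"
  assumes J: "right_ideal J" and c: "Poly_Mapping.keys c \<subseteq> T"
    and T: "\<And>t. t \<in> T \<Longrightarrow> mon t * r \<in> reducible T J"
  shows "c * r \<in> reducible T J"
proof -
  have zero: "0 \<in> reducible T J"
    using J unfolding reducible_def right_ideal_def by (auto intro!: exI[of _ 0])
  have "(\<Sum>t\<in>S. Poly_Mapping.single t (Poly_Mapping.lookup c t) * r) \<in> reducible T J" if "S \<subseteq> T" for S
    using that
  proof (induction S rule: infinite_finite_induct)
    case (insert t S)
    have "Poly_Mapping.single t (Poly_Mapping.lookup c t) * r = mon t * r * scalar (Poly_Mapping.lookup c t)"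
      using scalar_commute[of "Poly_Mapping.lookup c t" "mon t * r"]
      by (simp add: mult.assoc[symmetric] mult_single)
    then show ?case
      using insert reducible_add[OF J] reducible_scalar[OF J] T by simp
  qed (use zero in auto)
  from this[OF c] show ?thesis
    by (metis group_algebra_expansion sum_distrib_right)
qed

text \<open>
  The hypotheses make \<open>K T + J\<close> closed under right multiplication by generators and their inverses,
  and it contains \<open>1\<close>, so it is everything. This is used for \<open>J = I\<close>, to see that a maximal
  independent subtree spans modulo \<open>I\<close>, and for the \<open>J\<close> generated by Lewin's generators, to see that
  they generate \<open>I\<close>.
\<close>

lemma (in free_group) reducible_UNIV:
  fixes J :: "('f \<Rightarrow>\<^sub>0 'k::comm_ring_1) set"
  assumes J: "right_ideal J" and zero: "0 \<in> T"
    and step: "\<And>t x. t \<in> T \<Longrightarrow> x \<in> X \<Longrightarrow> mon (t + x) \<in> reducible T J"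
      "\<And>t x. t \<in> T \<Longrightarrow> x \<in> X \<Longrightarrow> mon (t - x) \<in> reducible T J"
  shows "a \<in> reducible T J"
proof -
  have J_sub: "b \<in> reducible T J" if "b \<in> J" for b
    using that unfolding reducible_def by (auto intro!: exI[of _ 0])
  have mult: "a * r \<in> reducible T J"
    if a: "a \<in> reducible T J" and r: "\<And>t. t \<in> T \<Longrightarrow> mon t * r \<in> reducible T J" for a r
  proof -
    obtain c where c: "Poly_Mapping.keys c \<subseteq> T" "a - c \<in> J"
      using a unfolding reducible_def by blast
    have "(a - c) * r + c * r \<in> reducible T J"
      using c J J_sub reducible_support[OF J c(1) r] by (intro reducible_add) (auto simp: right_ideal_def)
    then show ?thesis by (simp add: algebra_simps)
  qed
  have mon: "mon u \<in> reducible T J" for u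
  proof (induction u rule: normal_form_induct)
    case zero
    show ?case
      unfolding reducible_def using J \<open>0 \<in> T\<close>
      by (auto simp: right_ideal_def intro!: exI[of _ "mon 0"])
  next
    case (plus u x)
    then show ?case using mult[of "mon u" "mon x"] step by (simp add: mon_mult)
  next
    case (minus u x)
    then show ?case using mult[of "mon u" "mon (- x)"] step by (simp add: mon_mult)
  qed
  show ?thesis
  proof (induction a rule: group_algebra_induct)
    case (single u k)
    then show ?case using reducible_scalar[OF J mon[of u], of k] by (simp add: mult_single)
  qed (rule reducible_add[OF J])
qed

text \<open>
  A Schreier transversal: a subtree \<open>T\<close> of the Cayley tree whose elements form a \<open>K\<close>-basis of the
  quotient by \<open>I\<close>.
\<close>

locale schreier_transversal = free_group X
  for X :: "'f::group_add set" +
  fixes I :: "('f \<Rightarrow>\<^sub>0 'k::field) set" and T :: "'f set"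
  assumes right_ideal: "right_ideal I"
    and subtree: "subtree T"
    and independent: "\<And>c. Poly_Mapping.keys c \<subseteq> T \<Longrightarrow> c \<in> I \<Longrightarrow> c = 0"
    and spanning: "\<And>a. a \<in> reducible T I"
begin

definition reduct :: "('f \<Rightarrow>\<^sub>0 'k) \<Rightarrow> ('f \<Rightarrow>\<^sub>0 'k)" where
  "reduct a = (SOME c. Poly_Mapping.keys c \<subseteq> T \<and> a - c \<in> I)"

lemma reduct: "Poly_Mapping.keys (reduct a) \<subseteq> T" "a - reduct a \<in> I"
proof -
  have "\<exists>c. Poly_Mapping.keys c \<subseteq> T \<and> a - c \<in> I"
    using spanning[of a] by (simp add: reducible_def)
  from someI_ex[OF this] show "Poly_Mapping.keys (reduct a) \<subseteq> T" "a - reduct a \<in> I"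
    unfolding reduct_def by auto
qed

lemma reduct_eqI:
  assumes "Poly_Mapping.keys c \<subseteq> T" "a - c \<in> I" shows "reduct a = c"
proof -
  have "Poly_Mapping.keys (reduct a - c) \<subseteq> T"
    using keys_diff_subset[of "reduct a" c] assms(1) reduct(1)[of a] by blast
  moreover have "reduct a - c \<in> I"
    using right_ideal_diff[OF right_ideal assms(2) reduct(2)[of a]] by simp
  ultimately show ?thesis using independent by (metis eq_iff_diff_eq_0)
qed

lemma reduct_add: "reduct (a + b) = reduct a + reduct b"
proof (rule reduct_eqI)
  show "Poly_Mapping.keys (reduct a + reduct b) \<subseteq> T"
    using keys_add[of "reduct a" "reduct b"] reduct(1) by blast
  have "(a - reduct a) + (b - reduct b) \<in> I"
    using right_ideal reduct(2) unfolding right_ideal_def by blast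
  then show "a + b - (reduct a + reduct b) \<in> I" by (simp add: algebra_simps)
qed

lemma reduct_scalar: "reduct (scalar k * a) = scalar k * reduct a"
proof (rule reduct_eqI)
  show "Poly_Mapping.keys (scalar k * reduct a) \<subseteq> T"
    unfolding scalar_commute using keys_mult_scalar[of "reduct a" k] reduct(1)[of a] by blast
  have "(a - reduct a) * scalar k \<in> I"
    using right_ideal reduct(2) unfolding right_ideal_def by blast
  then show "scalar k * a - scalar k * reduct a \<in> I"
    by (simp add: scalar_commute algebra_simps)
qed

lemma reduct_in: "a \<in> I \<Longrightarrow> reduct a = 0"
  by (rule reduct_eqI) auto

lemma reduct_mon: "t \<in> T \<Longrightarrow> reduct (mon t) = mon t"
  using right_ideal by (intro reduct_eqI) (auto simp: right_ideal_def)

text \<open>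
  One generator for each edge of the Cayley tree that leaves \<open>T\<close> and is labelled by an element of \<open>X\<close>.
  The edges are those from \<open>t\<close> to \<open>t + x\<close>; edges leaving \<open>T\<close> along the inverse of an element of \<open>X\<close>
  are left out, because they yield redundant elements of \<open>I\<close>.
\<close>

definition generator :: "'f \<Rightarrow> 'f \<Rightarrow> ('f \<Rightarrow>\<^sub>0 'k)" where
  "generator t x = mon (t + x) - reduct (mon (t + x))"

definition generators :: "('f \<Rightarrow>\<^sub>0 'k) set" where
  "generators = {generator t x |t x. t \<in> T \<and> x \<in> X \<and> t + x \<notin> T}"

text \<open>
  Modulo the span \<open>J\<close> of the generators, \<open>K T\<close> is closed under multiplication by \<open>x \<in> X\<close> by
  construction. For the inverse of \<open>x\<close>, let \<open>m\<close> be the reduct of \<open>t x\<^sup>-\<^sup>1\<close> modulo \<open>I\<close>. Then \<open>m x\<close> reduces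
  modulo \<open>J\<close> to an element of \<open>K T\<close> that is congruent to \<open>t\<close> modulo \<open>I\<close>, hence equal to \<open>t\<close>; so
  \<open>t x\<^sup>-\<^sup>1\<close> is congruent to \<open>m\<close> modulo \<open>J\<close>. Thus \<open>K T + J\<close> is the whole algebra, and since \<open>K T\<close> meets
  \<open>I\<close> trivially, \<open>J = I\<close>.
\<close>

lemma right_span_generators: "right_span generators = I"
proof
  let ?J = "right_span generators"
  have J: "right_ideal ?J" by (rule right_ideal_right_span)
  show JI: "?J \<subseteq> I"
    unfolding generators_def generator_def
    using reduct(2) by (intro right_span_least[OF right_ideal]) auto
  have plus: "mon (t + x) \<in> reducible T ?J" if t: "t \<in> T" and x: "x \<in> X" for t x
  proof (cases "t + x \<in> T")
    case True
    then show ?thesis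
      using J unfolding reducible_def right_ideal_def by (auto intro!: exI[of _ "mon (t + x)"])
  next
    case False
    then have "generator t x \<in> ?J"
      using t x right_span_superset[of generators] unfolding generators_def by blast
    then show ?thesis
      unfolding generator_def reducible_def using reduct(1) by blast
  qed
  have minus: "mon (t - x) \<in> reducible T ?J" if t: "t \<in> T" and x: "x \<in> X" for t x
  proof -
    define m where "m = reduct (mon (t - x))"
    have "m * mon x \<in> reducible T ?J"
      unfolding m_def using plus[OF _ x] by (intro reducible_support[OF J reduct(1)]) (simp add: mon_mult)
    then obtain c where c: "Poly_Mapping.keys c \<subseteq> T" "m * mon x - c \<in> ?J"
      unfolding reducible_def by blast
    have "(mon (t - x) - m) * mon x \<in> I"
      using reduct(2)[of "mon (t - x)"] right_ideal unfolding m_def right_ideal_def by blast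
    then have "mon t - m * mon x \<in> I"
      by (simp add: left_diff_distrib mon_mult)
    moreover have "m * mon x - c \<in> I" using c(2) JI by blast
    ultimately have "(mon t - m * mon x) + (m * mon x - c) \<in> I"
      using right_ideal unfolding right_ideal_def by blast
    then have "mon t - c \<in> I" by simp
    then have "c = mon t" using reduct_eqI[OF c(1)] reduct_mon[OF t] by simp
    then have "m * mon x - mon t \<in> ?J" using c(2) by simp
    then have "(m * mon x - mon t) * mon (- x) \<in> ?J"
      using J unfolding right_ideal_def by blast
    then have "m - mon (t - x) \<in> ?J"
      by (simp add: left_diff_distrib mult.assoc mon_mult)
    then have "mon (t - x) - m \<in> ?J"
      using right_ideal_uminus[OF J] by fastforce
    then show ?thesis
      unfolding reducible_def m_def using reduct(1) by blast
  qed
  show "I \<subseteq> ?J"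
  proof
    fix a assume a: "a \<in> I"
    have "a \<in> reducible T ?J"
      using subtree by (intro reducible_UNIV[OF J _ plus minus]) (simp_all add: subtree_def)
    then obtain c where c: "Poly_Mapping.keys c \<subseteq> T" "a - c \<in> ?J"
      unfolding reducible_def by blast
    then have "c = 0" using reduct_eqI[OF c(1)] JI reduct_in[OF a] by auto
    then show "a \<in> ?J" using c by simp
  qed
qed

end

text \<open>
  A Fox derivative with prescribed increments: the solution of \<open>D(u x) = D(u) x + \<Delta>(u, x)\<close> with
  \<open>D(1) = 0\<close>, obtained by integrating \<open>\<Delta>\<close> along the path from \<open>1\<close>. The word is reversed, so that its
  first letter is the last edge of the path.
\<close>

primrec path_derivation ::
    "('f::group_add \<Rightarrow> 'f \<Rightarrow> ('f \<Rightarrow>\<^sub>0 'k::ring_1)) \<Rightarrow> ('f \<times> bool) list \<Rightarrow> ('f \<Rightarrow>\<^sub>0 'k)" where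
  "path_derivation \<Delta> [] = 0"
| "path_derivation \<Delta> (l # r) =
     (let u = word_value (rev r); x = fst l in
      if snd l then path_derivation \<Delta> r * mon x + \<Delta> u x
      else (path_derivation \<Delta> r - \<Delta> (u - x) x) * mon (- x))"

text \<open>
  The Cayley graph is a tree, so the rule for one direction of an edge determines the rule for the
  other, and the increments can be prescribed without any compatibility condition.
\<close>

lemma (in free_group) derivation_exists:
  fixes \<Delta> :: "'f \<Rightarrow> 'f \<Rightarrow> ('f \<Rightarrow>\<^sub>0 'k::ring_1)"
  obtains D where "D 0 = 0" "\<And>u x. x \<in> X \<Longrightarrow> D (u + x) = D u * mon x + \<Delta> u x"
proof
  let ?D = "\<lambda>u. path_derivation \<Delta> (rev (normal_form u))"
  have "normal_form 0 = []"
    by (intro normal_form_eqI) (simp_all add: reduced_word_def word_value_def)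
  then show "?D 0 = 0" by simp
  show "?D (u + x) = ?D u * mon x + \<Delta> u x" if "x \<in> X" for u x
    using normal_form_step[OF that, of u]
  proof
    assume "normal_form (u + x) = normal_form u @ [(x, True)]"
    then show ?thesis using normal_form(3)[of u] by (simp add: Let_def)
  next
    assume "normal_form u = normal_form (u + x) @ [(x, False)]"
    then have "?D u = (?D (u + x) - \<Delta> (u + x - x) x) * mon (- x)"
      using normal_form(3)[of "u + x"] by (simp add: Let_def)
    then have "?D u * mon x = ?D (u + x) - \<Delta> u x"
      by (simp add: mult.assoc mon_mult)
    then show ?thesis by simp
  qed
qed

context schreier_transversal
begin

text \<open>
  The coordinate functional of a generator. Integrate the increment that records, on edges labelled
  \<open>x\<close>, the coefficient of \<open>t\<close> in the reduct of the starting point. On \<open>I\<close> reducts vanish, so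
  the resulting derivative is linear there. It vanishes on \<open>T\<close>, since the edge from \<open>t\<close> to \<open>t + x\<close> is
  not inside \<open>T\<close>; so on a generator only the last edge contributes.
\<close>

lemma generator_functional:
  assumes t: "t \<in> T" and x: "x \<in> X" and tx: "t + x \<notin> T"
  obtains \<phi> where "right_linear_on I \<phi>" "\<phi> (generator t x) = 1"
    "\<And>s y. s \<in> T \<Longrightarrow> y \<in> X \<Longrightarrow> s + y \<notin> T \<Longrightarrow> (s, y) \<noteq> (t, x) \<Longrightarrow> \<phi> (generator s y) = 0"
proof -
  define \<Delta> :: "'f \<Rightarrow> 'f \<Rightarrow> ('f \<Rightarrow>\<^sub>0 'k)" where
    "\<Delta> u y = (if y = x then scalar (Poly_Mapping.lookup (reduct (mon u)) t) else 0)" for u y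
  obtain D where D0: "D 0 = 0" and D: "\<And>u y. y \<in> X \<Longrightarrow> D (u + y) = D u * mon y + \<Delta> u y"
    using derivation_exists[of \<Delta>] by blast
  let ?E = "linear_extension D"
  have \<Delta>T: "\<Delta> s y = (if s = t \<and> y = x then 1 else 0)" if "s \<in> T" for s y
    using reduct_mon[OF that] by (auto simp: \<Delta>_def lookup_single)
  have DT: "D s = 0" if "s \<in> T" for s
    using that
  proof (induction s rule: normal_form_induct)
    case (plus u y)
    then have u: "u \<in> T" using subtree unfolding subtree_def by blast
    then show ?case using plus D[OF plus(1), of u] tx \<Delta>T[OF u, of y] by auto
  next
    case (minus u y)
    then have u: "u \<in> T" using subtree unfolding subtree_def by blast
    have "D u = D (u - y) * mon y + \<Delta> (u - y) y"
      using D[OF minus(1), of "u - y"] by simp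
    moreover have "\<Delta> (u - y) y = 0"
      using \<Delta>T[OF minus.prems, of y] tx u by auto
    ultimately have "D (u - y) * mon y * mon (- y) = 0"
      using minus.IH[OF u] by simp
    then show ?case by (simp add: mult.assoc mon_mult)
  qed (rule D0)
  have E_T: "?E c = 0" if "Poly_Mapping.keys c \<subseteq> T" for c
    unfolding linear_extension_def using that DT by (intro sum.neutral) auto
  have E_step: "?E (a * mon y) = ?E a * mon y + (if y = x then scalar (Poly_Mapping.lookup (reduct a) t) else 0)"
    if y: "y \<in> X" for a y
  proof (induction a rule: group_algebra_induct)
    case (single u k)
    have "reduct (Poly_Mapping.single u k) = scalar k * reduct (mon u)"
      using reduct_scalar[of k "mon u"] by (simp add: mult_single)
    then have "(scalar (Poly_Mapping.lookup (reduct (Poly_Mapping.single u k)) t) :: 'f \<Rightarrow>\<^sub>0 'k) =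
        scalar k * scalar (Poly_Mapping.lookup (reduct (mon u)) t)"
      by (simp add: mult_single mult_map_scale_conv_mult[symmetric] Poly_Mapping.map.rep_eq when_def)
    then show ?case
      using y by (simp add: mult_single D \<Delta>_def distrib_left mult.assoc)
  next
    case (add a b)
    then show ?case
      by (auto simp: linear_extension_add distrib_right reduct_add lookup_add single_add)
  qed
  have E_plus: "?E (a * mon y) = ?E a * mon y" if "a \<in> I" "y \<in> X" for a y
    using E_step[OF that(2), of a] reduct_in[OF that(1)] by simp
  have I_mult: "a * r \<in> I" if "a \<in> I" for a r
    using that right_ideal by (simp add: right_ideal_def)
  \<comment> \<open>For an inverse letter, apply the rule for \<open>y\<close> to \<open>a y\<^sup>-\<^sup>1\<close>, which lies in \<open>I\<close> as well.\<close>
  have E_minus: "?E (a * mon (- y)) = ?E a * mon (- y)" if "a \<in> I" "y \<in> X" for a y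
  proof -
    have "?E (a * mon (- y) * mon y) = ?E (a * mon (- y)) * mon y"
      using that I_mult by (intro E_plus) auto
    then have "?E a * mon (- y) = ?E (a * mon (- y)) * mon y * mon (- y)"
      by (simp add: mult.assoc mon_mult)
    then show ?thesis by (simp add: mult.assoc mon_mult)
  qed
  have E_mon: "?E (a * mon u) = ?E a * mon u" if a: "a \<in> I" for a u
  proof (induction u rule: normal_form_induct)
    case (plus u y)
    then show ?case
      using E_plus[OF I_mult[OF a, of "mon u"], of y] by (simp add: mult.assoc mon_mult)
  next
    case (minus u y)
    then show ?case
      using E_minus[OF I_mult[OF a, of "mon u"], of y] by (simp add: mult.assoc mon_mult)
  qed simp
  have E_scalar: "?E (a * scalar k) = ?E a * scalar k" for a k
  proof (induction a rule: group_algebra_induct)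
    case (single u l)
    have "?E (Poly_Mapping.single u l * scalar k) = scalar k * (scalar l * D u)"
      by (simp add: mult_single mult.assoc[symmetric] mult.commute)
    then show ?case by (simp add: scalar_commute)
  qed (simp add: linear_extension_add distrib_right)
  have "right_linear_on I ?E"
    unfolding right_linear_on_def
  proof (intro conjI ballI allI)
    fix a r assume a: "a \<in> I"
    show "?E (a * r) = ?E a * r"
    proof (induction r rule: group_algebra_induct)
      case (single u k)
      have "?E (a * mon u * scalar k) = ?E a * mon u * scalar k"
        using E_scalar[of "a * mon u"] E_mon[OF a] by simp
      then show ?case by (simp add: mult.assoc mult_single)
    qed (simp add: linear_extension_add distrib_left)
  qed (rule linear_extension_add)
  moreover have E_gen: "?E (generator s y) = \<Delta> s y" if "s \<in> T" "y \<in> X" for s y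
  proof -
    have "mon (s + y) = generator s y + reduct (mon (s + y))"
      by (simp add: generator_def)
    then have "?E (mon (s + y)) = ?E (generator s y) + ?E (reduct (mon (s + y)))"
      using linear_extension_add by metis
    then show ?thesis
      using D[OF that(2), of s] DT[OF that(1)] E_T[OF reduct(1)] by simp
  qed
  ultimately show ?thesis
    using that[of ?E] t x \<Delta>T by auto
qed

lemma right_basis_generators: "right_basis generators I"
  unfolding right_basis_def
proof (intro conjI right_span_generators)
  show "right_independent generators"
    unfolding right_independent_def
  proof (intro allI impI ballI, elim conjE)
    fix S c f assume S: "finite S" "S \<subseteq> generators" and zero: "(\<Sum>f\<in>S. f * c f) = 0" and f: "f \<in> S"
    have SI: "S \<subseteq> I"
      using S(2) right_span_superset[of generators] right_span_generators by blast
    obtain t x where tx: "t \<in> T" "x \<in> X" "t + x \<notin> T" "f = generator t x"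
      using f S(2) unfolding generators_def by blast
    obtain \<phi> where \<phi>: "right_linear_on I \<phi>" "\<phi> f = 1"
      "\<And>s y. s \<in> T \<Longrightarrow> y \<in> X \<Longrightarrow> s + y \<notin> T \<Longrightarrow> (s, y) \<noteq> (t, x) \<Longrightarrow> \<phi> (generator s y) = 0"
      using generator_functional[OF tx(1-3)] tx(4) by blast
    have other: "\<phi> g = 0" if g: "g \<in> S" "g \<noteq> f" for g
    proof -
      obtain s y where sy: "s \<in> T" "y \<in> X" "s + y \<notin> T" "g = generator s y"
        using g(1) S(2) unfolding generators_def by blast
      then show ?thesis using \<phi>(3)[OF sy(1-3)] g(2) tx(4) by auto
    qed
    have "\<phi> (\<Sum>f\<in>S. f * c f) = (\<Sum>f\<in>S. \<phi> f * c f)"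
      using SI by (intro right_linear_on_sum[OF \<phi>(1) right_ideal]) auto
    also have "\<dots> = (\<Sum>f\<in>{f}. \<phi> f * c f)"
      using S(1) f other by (intro sum.mono_neutral_right) auto
    finally show "c f = 0"
      using zero \<phi>(2) right_linear_on_sum[OF \<phi>(1) right_ideal, of "{}"] by simp
  qed
qed

end

text \<open>
  Take a subtree that is maximal among those independent modulo \<open>I\<close>. If a neighbour of the subtree
  is not in \<open>K T + I\<close>, it can be added, so maximality forces spanning. The case \<open>1 \<in> I\<close> is excluded
  because a subtree contains the root.
\<close>

lemma (in free_group) schreier_transversal_exists:
  fixes I :: "('f \<Rightarrow>\<^sub>0 'k::field) set"
  assumes I: "right_ideal I" and proper: "1 \<notin> I"
  obtains T where "schreier_transversal X I T"
proof -
  let ?indep = "\<lambda>T. \<forall>c. Poly_Mapping.keys c \<subseteq> T \<longrightarrow> c \<in> I \<longrightarrow> c = 0"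
  define \<A> where "\<A> = {T. subtree T \<and> ?indep T}"
  have mult: "a * r \<in> I" if "a \<in> I" for a r
    using that I by (simp add: right_ideal_def)
  \<comment> \<open>Solve a relation modulo \<open>I\<close> for a term \<open>v\<close> with nonzero coefficient.\<close>
  have cancel: "mon v \<in> reducible T I"
    if c: "Poly_Mapping.keys c \<subseteq> insert v T" "c \<in> I" and v: "Poly_Mapping.lookup c v \<noteq> 0" for c v T
  proof -
    let ?d = "c * scalar (inverse (Poly_Mapping.lookup c v))"
    have lookup: "Poly_Mapping.lookup ?d u = inverse (Poly_Mapping.lookup c v) * Poly_Mapping.lookup c u" for u
      by (simp add: scalar_commute[symmetric] mult_map_scale_conv_mult[symmetric]
          Poly_Mapping.map.rep_eq when_def)
    have "Poly_Mapping.keys (mon v - ?d) \<subseteq> T"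
      using c(1) v by (auto simp: in_keys_iff lookup_minus lookup lookup_single when_def split: if_splits)
    moreover have "mon v - (mon v - ?d) \<in> I" using mult[OF c(2)] by simp
    ultimately show ?thesis unfolding reducible_def by blast
  qed
  have "subtree {0}"
    unfolding subtree_def
  proof (intro conjI allI impI, simp, elim conjE)
    fix u l g assume "g \<in> {0 :: 'f}" "normal_form g = normal_form u @ [l]"
    moreover have "normal_form 0 = []"
      by (intro normal_form_eqI) (simp_all add: reduced_word_def word_value_def)
    ultimately show "u \<in> {0}" by simp
  qed
  moreover have "?indep {0}"
  proof (intro allI impI, rule ccontr)
    fix c assume c: "Poly_Mapping.keys c \<subseteq> {0}" "c \<in> I" "c \<noteq> 0"
    then have "Poly_Mapping.lookup c 0 \<noteq> 0"
      by (metis keys_eq_empty not_in_keys_iff_lookup_eq_zero subset_singletonD singletonI)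
    then have "mon 0 \<in> reducible {} I" using cancel[of c 0 "{}"] c by simp
    then show False using proper by (simp add: reducible_def)
  qed
  ultimately have nonempty: "\<A> \<noteq> {}" unfolding \<A>_def by blast
  have union: "\<Union>\<C> \<in> \<A>" if \<C>: "\<C> \<noteq> {}" "subset.chain \<A> \<C>" for \<C>
  proof -
    have sub: "\<C> \<subseteq> {T. subtree T \<and> ?indep T}"
      using \<C>(2) unfolding \<A>_def by (auto simp: subset.chain_def)
    have "subtree (\<Union>\<C>)"
      using sub \<C>(1) unfolding subtree_def by blast
    moreover have "c = 0" if c: "Poly_Mapping.keys c \<subseteq> \<Union>\<C>" "c \<in> I" for c
    proof -
      obtain T where "T \<in> \<C>" "Poly_Mapping.keys c \<subseteq> T"
        using finite_subset_Union_chain[OF finite_keys c(1) \<C>] by blast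
      then show ?thesis using sub c(2) by blast
    qed
    ultimately show ?thesis unfolding \<A>_def by blast
  qed
  obtain T where "T \<in> \<A>" and maximal: "\<And>S. S \<in> \<A> \<Longrightarrow> T \<subseteq> S \<Longrightarrow> S = T"
    using subset_Zorn_nonempty[OF nonempty union] by blast
  then have T: "subtree T" "\<And>c. Poly_Mapping.keys c \<subseteq> T \<Longrightarrow> c \<in> I \<Longrightarrow> c = 0"
    unfolding \<A>_def by auto
  have neighbour: "mon v \<in> reducible T I" if "t \<in> T" "x \<in> X" "v = t + x \<or> v = t - x" for t x v
  proof (cases "v \<in> T")
    case True
    then show ?thesis
      using I unfolding reducible_def right_ideal_def by (auto intro!: exI[of _ "mon v"])
  next
    case False
    have "subtree (insert v T)" using subtree_insert[OF T(1)] that by blast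
    then have "\<not> ?indep (insert v T)"
      using maximal[of "insert v T"] False unfolding \<A>_def by blast
    then obtain c where c: "Poly_Mapping.keys c \<subseteq> insert v T" "c \<in> I" "c \<noteq> 0" by blast
    have "Poly_Mapping.lookup c v \<noteq> 0"
    proof
      assume "Poly_Mapping.lookup c v = 0"
      then have "Poly_Mapping.keys c \<subseteq> T" using c(1) by (auto simp: in_keys_iff)
      then show False using T(2) c by blast
    qed
    then show ?thesis using cancel c by blast
  qed
  have "schreier_transversal X I T"
  proof
    have "0 \<in> T" using T(1) by (simp add: subtree_def)
    then show "a \<in> reducible T I" for a
      using reducible_UNIV[OF I _ neighbour[OF _ _ disjI1[OF refl]] neighbour[OF _ _ disjI2[OF refl]]]
      by blast
  qed (use I T in auto)
  then show ?thesis by (rule that)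
qed

theorem (in free_group) right_ideal_has_basis:
  fixes I :: "('f \<Rightarrow>\<^sub>0 'k::field) set"
  assumes "right_ideal I"
  shows "\<exists>B. right_basis B I"
proof (cases "1 \<in> I")
  case True
  have "right_independent {1 :: 'f \<Rightarrow>\<^sub>0 'k}"
    unfolding right_independent_def by (auto simp: subset_singleton_iff)
  moreover have "right_span {1} = I"
  proof
    show "right_span {1} \<subseteq> I" using assms True by (intro right_span_least) auto
    show "I \<subseteq> right_span {1}"
    proof
      fix a assume "a \<in> I"
      show "a \<in> right_span {1}" using right_spanI[of "{1}" "{1}" "\<lambda>_. a"] by simp
    qed
  qed
  ultimately show ?thesis unfolding right_basis_def by blast
next
  case False
  then obtain T where "schreier_transversal X I T"
    using schreier_transversal_exists[OF assms] by blast
  then show ?thesis using schreier_transversal.right_basis_generators by blast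
qed

section \<open>Invariance of rank\<close>

text \<open>
  An \<open>m \<times> n\<close> matrix over a field with a right inverse has \<open>m \<le> n\<close>, because the \<open>m\<close> unit vectors are
  combinations of the \<open>n\<close> rows of that inverse. Finitely supported functions on the natural numbers
  serve as the ambient vector space.
\<close>

lemma right_invertible_matrix_rows_le_columns:
  fixes P Q :: "nat \<Rightarrow> nat \<Rightarrow> 'k::field"
  assumes PQ: "\<And>i j. i < m \<Longrightarrow> j < m \<Longrightarrow> (\<Sum>k<n. P i k * Q k j) = (if i = j then 1 else 0)"
  shows "m \<le> n"
proof -
  let ?scale = "\<lambda>(c::'k) (p::nat \<Rightarrow>\<^sub>0 'k). scalar c * p"
  interpret V: vector_space ?scale
    by unfold_locales (simp_all add: distrib_left distrib_right single_add mult.assoc[symmetric] mult_single)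
  define e :: "nat \<Rightarrow> (nat \<Rightarrow>\<^sub>0 'k)" where "e i = mon i" for i
  define v :: "nat \<Rightarrow> (nat \<Rightarrow>\<^sub>0 'k)" where "v k = (\<Sum>j<m. Poly_Mapping.single j (Q k j))" for k
  have inj: "inj_on e {..<m}"
    by (auto simp: inj_on_def e_def poly_mapping_eq_iff fun_eq_iff lookup_single when_def split: if_splits)
  have "V.independent (e ` {..<m})"
  proof (rule V.independent_if_scalars_zero)
    fix c x assume zero: "(\<Sum>x\<in>e ` {..<m}. ?scale (c x) x) = 0" and x: "x \<in> e ` {..<m}"
    obtain i where i: "i < m" "x = e i" using x by blast
    have "(\<Sum>x\<in>e ` {..<m}. ?scale (c x) x) = (\<Sum>i<m. Poly_Mapping.single i (c (e i)))"
      unfolding sum.reindex[OF inj] by (simp add: e_def mult_single)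
    then have "Poly_Mapping.lookup (\<Sum>i<m. Poly_Mapping.single i (c (e i))) i = 0"
      using zero by simp
    then show "c x = 0"
      using i by (simp add: lookup_sum lookup_single when_def)
  qed simp
  moreover have "e ` {..<m} \<subseteq> V.span (v ` {..<n})"
  proof
    fix x assume "x \<in> e ` {..<m}"
    then obtain i where i: "i < m" "x = e i" by blast
    have "(\<Sum>k<n. ?scale (P i k) (v k)) = (\<Sum>k<n. \<Sum>j<m. Poly_Mapping.single j (P i k * Q k j))"
      by (simp add: v_def sum_distrib_left mult_single)
    also have "\<dots> = (\<Sum>j<m. \<Sum>k<n. Poly_Mapping.single j (P i k * Q k j))"
      by (rule sum.swap)
    also have "\<dots> = (\<Sum>j<m. Poly_Mapping.single j (\<Sum>k<n. P i k * Q k j))"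
    proof -
      have single_sum: "(\<Sum>k\<in>S. Poly_Mapping.single j (g k)) = Poly_Mapping.single j (sum g S)"
        for j :: nat and g :: "nat \<Rightarrow> 'k" and S
        by (induction S rule: infinite_finite_induct) (simp_all add: single_add)
      show ?thesis by (simp add: single_sum)
    qed
    also have "\<dots> = (\<Sum>j<m. if i = j then mon j else 0)"
      using i PQ by (intro sum.cong) auto
    also have "\<dots> = e i" using i by (simp add: e_def)
    finally have x: "x = (\<Sum>k<n. ?scale (P i k) (v k))" using i by simp
    show "x \<in> V.span (v ` {..<n})"
      unfolding x by (intro V.span_sum V.span_scale V.span_base) auto
  qed
  ultimately have "card (e ` {..<m}) \<le> card (v ` {..<n})"
    using V.independent_span_bound[of "v ` {..<n}" "e ` {..<m}"] by simp
  then show ?thesis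
    using inj card_image_le[of "{..<n}" v] by (simp add: card_image)
qed

text \<open>
  Expressing two bases in terms of each other gives matrices over the ring whose product is the
  identity; a ring homomorphism \<open>\<epsilon>\<close> to a field turns them into matrices over the field.
\<close>

lemma right_free_length_le:
  fixes f g :: "nat \<Rightarrow> 'a::ring_1" and \<epsilon> :: "'a \<Rightarrow> 'k::field"
  assumes hom: "\<epsilon> 1 = 1" "\<And>a b. \<epsilon> (a + b) = \<epsilon> a + \<epsilon> b" "\<And>a b. \<epsilon> (a * b) = \<epsilon> a * \<epsilon> b"
    and f: "right_free f m" and eq: "right_comb f m = right_comb g n"
  shows "m \<le> n"
proof -
  have zero: "\<epsilon> 0 = 0" using hom(2)[of 0 0] by (metis add_0 add_cancel_right_right)
  have sum: "\<epsilon> (sum h S) = (\<Sum>x\<in>S. \<epsilon> (h x))" for h :: "nat \<Rightarrow> 'a" and S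
    by (induction S rule: infinite_finite_induct) (simp_all add: zero hom)
  have f_in: "\<exists>c. f i = (\<Sum>k<n. g k * c k)" if "i < m" for i
    using right_basis_subset[OF right_basis_right_free[OF f]] that eq unfolding right_comb_def by blast
  have g_in: "\<exists>d. g k = (\<Sum>l<m. f l * d l)" if "k < n" for k
  proof -
    have "(\<Sum>j<n. g j * (if j = k then 1 else 0)) = (\<Sum>j<n. if j = k then g j else 0)"
      by (intro sum.cong) auto
    also have "\<dots> = g k" using that by simp
    finally have "g k \<in> right_comb g n"
      unfolding right_comb_def by (intro image_eqI[where x = "\<lambda>j. if j = k then 1 else 0"]) auto
    then have "g k \<in> right_comb f m" by (simp only: eq)
    then show ?thesis unfolding right_comb_def by blast
  qed
  obtain P where P: "\<And>i. i < m \<Longrightarrow> f i = (\<Sum>k<n. g k * P i k)"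
    using f_in by metis
  obtain Q where Q: "\<And>k. k < n \<Longrightarrow> g k = (\<Sum>l<m. f l * Q k l)"
    using g_in by metis
  have id: "(\<Sum>k<n. Q k l * P i k) = (if l = i then 1 else 0)" if l: "l < m" and i: "i < m" for l i
  proof -
    have "f i = (\<Sum>k<n. \<Sum>l<m. f l * (Q k l * P i k))"
      unfolding P[OF i] using Q by (intro sum.cong) (auto simp: sum_distrib_right mult.assoc)
    also have "\<dots> = (\<Sum>l<m. f l * (\<Sum>k<n. Q k l * P i k))"
      by (subst sum.swap) (simp add: sum_distrib_left)
    finally have "(\<Sum>l<m. f l * (\<Sum>k<n. Q k l * P i k)) = f i" ..
    moreover have "(\<Sum>l<m. f l * (if l = i then 1 else 0)) = (\<Sum>l<m. if l = i then f l else 0)"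
      by (intro sum.cong) auto
    moreover have "(\<Sum>l<m. if l = i then f l else 0) = f i" using i by simp
    ultimately have "(\<Sum>l<m. f l * ((\<Sum>k<n. Q k l * P i k) - (if l = i then 1 else 0))) = 0"
      unfolding right_diff_distrib sum_subtractf by simp
    from right_freeD[OF f this l] show ?thesis by simp
  qed
  have "(\<Sum>k<n. \<epsilon> (Q k l) * \<epsilon> (P i k)) = (if l = i then 1 else 0)" if "l < m" "i < m" for l i
    using arg_cong[OF id[OF that], of \<epsilon>] by (simp add: sum hom zero split: if_splits)
  then show ?thesis by (rule right_invertible_matrix_rows_le_columns)
qed

text \<open>
  Finitely many elements of \<open>C\<close> suffice to express the finite basis, hence to span the ideal; the
  coordinate of any other element of \<open>C\<close> would vanish on that span, which contains the element.
\<close>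

lemma right_basis_of_right_comb_finite:
  assumes C: "right_basis C (right_comb f n)" and f: "right_free f n"
  shows "finite C"
proof -
  let ?I = "right_comb f n"
  have basis: "right_basis (f ` {..<n}) ?I" by (rule right_basis_right_free[OF f])
  have "\<exists>T. finite T \<and> T \<subseteq> C \<and> f i \<in> right_span T" if "i < n" for i
  proof -
    have "f i \<in> right_span C"
      using right_basis_subset[OF basis] C that by (auto simp: right_basis_def)
    then obtain T c where "finite T" "T \<subseteq> C" "f i = (\<Sum>g\<in>T. g * c g)"
      unfolding right_span_def by blast
    then show ?thesis using right_spanI[of T T c] by auto
  qed
  then obtain T where T: "\<And>i. i < n \<Longrightarrow> finite (T i) \<and> T i \<subseteq> C \<and> f i \<in> right_span (T i)"
    by metis
  define S where "S = (\<Union>i<n. T i)"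
  have S: "finite S" "S \<subseteq> C" using T by (auto simp: S_def)
  have "f ` {..<n} \<subseteq> right_span S"
  proof
    fix g assume "g \<in> f ` {..<n}"
    then obtain i where i: "i < n" "g = f i" by blast
    have "right_span (T i) \<subseteq> right_span S"
      using i right_span_superset[of S]
      by (intro right_span_least[OF right_ideal_right_span]) (auto simp: S_def)
    then show "g \<in> right_span S" using T[OF i(1)] i(2) by blast
  qed
  then have "?I \<subseteq> right_span S"
    using right_span_least[OF right_ideal_right_span, of "f ` {..<n}" S] basis
    by (simp add: right_basis_def)
  moreover have "right_span S \<subseteq> ?I"
    using right_span_least[OF right_ideal_right_basis[OF C]] S(2) right_basis_subset[OF C] by blast
  ultimately have span: "right_span S = ?I" by blast
  have "C \<subseteq> S"
  proof
    fix g assume g: "g \<in> C"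
    show "g \<in> S"
    proof (rule ccontr)
      assume "g \<notin> S"
      obtain \<phi> where \<phi>: "right_linear_on ?I \<phi>" "\<And>h. h \<in> C \<Longrightarrow> \<phi> h = (if h = g then 1 else 0)"
        using right_basis_functional[OF C, where h = "\<lambda>h. if h = g then 1 else 0"] by blast
      have "\<phi> g = 0"
      proof (rule right_linear_on_eqI[where I = ?I and B = S and \<phi> = \<phi> and \<psi> = "\<lambda>_. 0" and x = g])
        show "g \<in> ?I" using g right_basis_subset[OF C] by blast
        show "\<phi> h = 0" if "h \<in> S" for h
          using \<phi>(2)[of h] S(2) that \<open>g \<notin> S\<close> by auto
      qed (use \<phi>(1) span in \<open>auto simp: right_linear_on_def\<close>)
      then show False using \<phi>(2)[OF g] by simp
    qed
  qed
  then show ?thesis using S(1) finite_subset by blast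
qed

lemma right_rank_right_comb:
  fixes f :: "nat \<Rightarrow> 'a::ring_1" and \<epsilon> :: "'a \<Rightarrow> 'k::field"
  assumes hom: "\<epsilon> 1 = 1" "\<And>a b. \<epsilon> (a + b) = \<epsilon> a + \<epsilon> b" "\<And>a b. \<epsilon> (a * b) = \<epsilon> a * \<epsilon> b"
    and f: "right_free f n"
  shows "right_rank (right_comb f n) = enat n"
proof -
  have rank: "finite C \<and> card C = n" if C: "right_basis C (right_comb f n)" for C
  proof -
    have fin: "finite C" by (rule right_basis_of_right_comb_finite[OF C f])
    obtain g where g: "right_free g (card C)" "C = g ` {..<card C}"
      "right_comb f n = right_comb g (card C)"
      by (rule right_free_of_right_basis[OF C fin])
    have "card C \<le> n" by (rule right_free_length_le[OF hom g(1) g(3)[symmetric]])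
    moreover have "n \<le> card C" by (rule right_free_length_le[OF hom f g(3)])
    ultimately show ?thesis using fin by simp
  qed
  have basis: "right_basis (f ` {..<n}) (right_comb f n)" by (rule right_basis_right_free[OF f])
  show ?thesis
    unfolding right_rank_def
  proof (rule the_equality)
    show "\<exists>B. right_basis B (right_comb f n) \<and> enat n = (if finite B then enat (card B) else \<infinity>)"
      using basis rank[OF basis] by (intro exI[of _ "f ` {..<n}"]) auto
  qed (use rank in auto)
qed

section \<open>Augmentation and inversion\<close>

definition augmentation :: "('f \<Rightarrow>\<^sub>0 'k::comm_monoid_add) \<Rightarrow> 'k" where
  "augmentation a = (\<Sum>u\<in>Poly_Mapping.keys a. Poly_Mapping.lookup a u)"

lemma augmentation_single [simp]: "augmentation (Poly_Mapping.single u k) = k"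
  by (simp add: augmentation_def)

lemma augmentation_add: "augmentation (a + b) = augmentation a + augmentation b"
  unfolding augmentation_def by (rule setsum_keys_plus_distrib) simp_all

lemma augmentation_mult:
  fixes a b :: "'f::monoid_add \<Rightarrow>\<^sub>0 'k::semiring_1"
  shows "augmentation (a * b) = augmentation a * augmentation b"
proof (induction a rule: group_algebra_induct)
  case (single u k)
  show ?case
    by (induction b rule: group_algebra_induct)
      (simp_all add: mult_single augmentation_add distrib_left)
qed (simp add: augmentation_add distrib_right)

lemma augmentation_one: "augmentation (1 :: 'f::zero \<Rightarrow>\<^sub>0 'k::{comm_monoid_add,zero_neq_one}) = 1"
  using augmentation_single[of "0 :: 'f" "1 :: 'k"] by simp

lemma iota_single [simp]: "iota (Poly_Mapping.single u k) = Poly_Mapping.single (- u) k"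
  by (simp add: iota_def)

lemma iota_add: "iota (a + b) = iota a + iota b"
  unfolding iota_def by (rule setsum_keys_plus_distrib) (simp_all add: single_add)

lemma iota_zero [simp]: "iota 0 = 0"
  by (simp add: iota_def)

lemma iota_uminus: "iota (- a) = - iota a"
  using iota_add[of a "- a"] by (simp add: eq_neg_iff_add_eq_0 add.commute)

lemma iota_sum: "iota (sum g S) = (\<Sum>x\<in>S. iota (g x))"
  by (induction S rule: infinite_finite_induct) (simp_all add: iota_add)

lemma iota_iota [simp]: "iota (iota a) = a"
  by (induction a rule: group_algebra_induct) (simp_all add: iota_add)

lemma iota_mult:
  fixes a b :: "'f::group_add \<Rightarrow>\<^sub>0 'k::comm_ring_1"
  shows "iota (a * b) = iota b * iota a"
proof (induction a rule: group_algebra_induct)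
  case (single u k)
  show ?case
    by (induction b rule: group_algebra_induct)
      (simp_all add: mult_single minus_add mult.commute iota_add distrib_left distrib_right)
qed (simp add: iota_add distrib_left distrib_right)

lemma iota_left_comb:
  fixes b :: "nat \<Rightarrow> ('f::group_add \<Rightarrow>\<^sub>0 'k::comm_ring_1)"
  shows "iota ` left_comb b n = right_comb (\<lambda>i. iota (b i)) n"
proof
  show "iota ` left_comb b n \<subseteq> right_comb (\<lambda>i. iota (b i)) n"
    unfolding left_comb_def right_comb_def by (auto simp: iota_sum iota_mult)
  show "right_comb (\<lambda>i. iota (b i)) n \<subseteq> iota ` left_comb b n"
  proof
    fix x assume "x \<in> right_comb (\<lambda>i. iota (b i)) n"
    then obtain c where "x = (\<Sum>i<n. iota (b i) * c i)" unfolding right_comb_def by blast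
    then have "x = iota (\<Sum>i<n. iota (c i) * b i)" by (simp add: iota_sum iota_mult)
    then show "x \<in> iota ` left_comb b n"
      unfolding left_comb_def by (intro image_eqI[OF _ rangeI])
  qed
qed

lemma right_free_iota:
  fixes b :: "nat \<Rightarrow> ('f::group_add \<Rightarrow>\<^sub>0 'k::comm_ring_1)"
  assumes "left_free b n" shows "right_free (\<lambda>i. iota (b i)) n"
  unfolding right_free_def
proof (intro allI impI)
  fix c i assume "(\<Sum>i<n. iota (b i) * c i) = 0" and i: "i < n"
  then have "iota (\<Sum>i<n. iota (b i) * c i) = 0" by simp
  then have "(\<Sum>i<n. iota (c i) * b i) = 0" by (simp add: iota_sum iota_mult)
  then have "iota (c i) = 0" using left_freeD[OF assms, of "\<lambda>i. iota (c i)"] i by blast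
  then have "iota (iota (c i)) = 0" by simp
  then show "c i = 0" by simp
qed

lemma left_free_iota:
  fixes f :: "nat \<Rightarrow> ('f::group_add \<Rightarrow>\<^sub>0 'k::comm_ring_1)"
  assumes "right_free f n" shows "left_free (\<lambda>i. iota (f i)) n"
  unfolding left_free_def
proof (intro allI impI)
  fix a i assume "(\<Sum>i<n. a i * iota (f i)) = 0" and i: "i < n"
  then have "iota (\<Sum>i<n. a i * iota (f i)) = 0" by simp
  then have "(\<Sum>i<n. f i * iota (a i)) = 0" by (simp add: iota_sum iota_mult)
  then have "iota (a i) = 0" using right_freeD[OF assms, of "\<lambda>i. iota (a i)"] i by blast
  then have "iota (iota (a i)) = 0" by simp
  then show "a i = 0" by simp
qed

section \<open>The involution\<close>

lemma left_free_times_unit: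
  assumes b: "left_free b n" and unit: "v * v' = 1"
  shows "left_free (\<lambda>i. b i * v) n"
  unfolding left_free_def
proof (intro allI impI)
  fix a i assume "(\<Sum>i<n. a i * (b i * v)) = 0" and i: "i < n"
  then have "(\<Sum>i<n. a i * b i) * v = 0" by (simp add: sum_distrib_right mult.assoc)
  then have "(\<Sum>i<n. a i * b i) * v * v' = 0" by simp
  then have "(\<Sum>i<n. a i * b i) = 0" by (simp add: mult.assoc unit)
  from left_freeD[OF b this i] show "a i = 0" .
qed

text \<open>
  Applying \<open>\<iota>\<close> to \<open>q = \<Sum> f\<^sub>i b\<^sub>i\<close> swaps the factors. The left side becomes \<open>w\<^sup>-\<^sup>1 - 1 = - q w\<^sup>-\<^sup>1\<close>, so
  multiplying by \<open>- w\<close> gives back \<open>q\<close>.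
\<close>

lemma dual_factorization:
  fixes f b :: "nat \<Rightarrow> ('f::group_add \<Rightarrow>\<^sub>0 'k::comm_ring_1)"
  assumes q: "mon w - 1 = (\<Sum>i<n. f i * b i)"
  shows "mon w - 1 = (\<Sum>i<n. iota (b i) * (iota (f i) * - mon w))"
proof -
  have "iota (mon w - 1) = (mon (- w) - 1 :: 'f \<Rightarrow>\<^sub>0 'k)"
    using iota_add[of "mon w :: 'f \<Rightarrow>\<^sub>0 'k" "- 1"] iota_single[of "0 :: 'f" "1 :: 'k"] by (simp add: iota_uminus)
  then have "mon (- w) - 1 = (\<Sum>i<n. iota (b i) * iota (f i))"
    unfolding q by (simp add: iota_sum iota_mult)
  then have "(mon (- w) - 1) * - mon w = (\<Sum>i<n. iota (b i) * (iota (f i) * - mon w))"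
    by (simp only: sum_distrib_right mult.assoc)
  moreover have "(mon (- w) - 1) * - mon w = (mon w - 1 :: 'f \<Rightarrow>\<^sub>0 'k)"
    by (simp add: algebra_simps mon_mult)
  ultimately show ?thesis by simp
qed

text \<open>
  Left multiplication by \<open>w\<close> maps \<open>I\<close> to itself, although \<open>I\<close> is only a right ideal, because
  \<open>w x = (w - 1) x + x\<close>; likewise \<open>w\<^sup>-\<^sup>1 x = x - (w - 1) w\<^sup>-\<^sup>1 x\<close>.
\<close>

lemma translate_right_ideal:
  fixes I :: "('f::group_add \<Rightarrow>\<^sub>0 'k::comm_ring_1) set"
  assumes I: "right_ideal I" and q: "mon w - 1 \<in> I"
  shows "(\<lambda>x. - mon (- w) * x) ` I = I"
proof
  have mult: "x * r \<in> I" if "x \<in> I" for x r using I that by (simp add: right_ideal_def)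
  show "(\<lambda>x. - mon (- w) * x) ` I \<subseteq> I"
  proof
    fix y assume "y \<in> (\<lambda>x. - mon (- w) * x) ` I"
    then obtain x where x: "x \<in> I" "y = - mon (- w) * x" by blast
    have "(mon w - 1) * (mon (- w) * x) = x + y"
      by (simp add: x(2) left_diff_distrib mult.assoc[symmetric] mon_mult)
    then have "(mon w - 1) * (mon (- w) * x) - x = y" by simp
    then show "y \<in> I" using right_ideal_diff[OF I mult[OF q] x(1)] by metis
  qed
  show "I \<subseteq> (\<lambda>x. - mon (- w) * x) ` I"
  proof
    fix x assume x: "x \<in> I"
    have "- x - (mon w - 1) * x \<in> I"
      by (rule right_ideal_diff[OF I right_ideal_uminus[OF I x] mult[OF q]])
    then have "- (mon w * x) \<in> I" by (simp add: left_diff_distrib)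
    moreover have "x = - mon (- w) * - (mon w * x)"
      by (simp add: mult.assoc[symmetric] mon_mult)
    ultimately show "x \<in> (\<lambda>x. - mon (- w) * x) ` I" by blast
  qed
qed

text \<open>
  In the factorization \<open>q = \<Sum> f\<^sub>i b\<^sub>i\<close> of an algebraic extension the two families play symmetric roles:
  one is a right basis of \<open>I\<close>, the other a left basis of the dual. The inversion exchanges them up to
  the unit \<open>- w\<close>, so applying the map twice yields \<open>w\<^sup>-\<^sup>1 I\<close>, which is \<open>I\<close> again.
\<close>

lemma iota_Q_dual:
  fixes f b :: "nat \<Rightarrow> ('f::group_add \<Rightarrow>\<^sub>0 'k::field)"
  assumes f: "right_free f n" and b: "left_free b n" and q: "mon w - 1 = (\<Sum>i<n. f i * b i)"
  shows "iota ` Q_dual (mon w - 1) (right_comb f n) = right_comb (\<lambda>i. iota (b i)) n"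
    and "algebraic_extension (right_span {mon w - 1}) (right_comb (\<lambda>i. iota (b i)) n)"
    and "iota ` Q_dual (mon w - 1) (right_comb (\<lambda>i. iota (b i)) n) = right_comb f n"
proof -
  let ?b' = "\<lambda>i. iota (f i) * - mon w"
  have f': "right_free (\<lambda>i. iota (b i)) n" by (rule right_free_iota[OF b])
  have b': "left_free ?b' n"
    by (rule left_free_times_unit[OF left_free_iota[OF f], where v' = "- mon (- w)"]) (simp add: mon_mult)
  have q': "mon w - 1 = (\<Sum>i<n. iota (b i) * ?b' i)" by (rule dual_factorization[OF q])
  show "iota ` Q_dual (mon w - 1) (right_comb f n) = right_comb (\<lambda>i. iota (b i)) n"
    unfolding q Q_dual_right_comb[OF f] by (rule iota_left_comb)
  show "algebraic_extension (right_span {mon w - 1}) (right_comb (\<lambda>i. iota (b i)) n)"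
    by (rule factorization_algebraic_extension[OF f' b' q'])
  have "iota ` Q_dual (mon w - 1) (right_comb (\<lambda>i. iota (b i)) n) = iota ` left_comb ?b' n"
    unfolding q' Q_dual_right_comb[OF f'] ..
  also have "\<dots> = right_comb (\<lambda>i. - mon (- w) * f i) n"
    by (simp add: iota_left_comb iota_mult iota_uminus)
  also have "\<dots> = (\<lambda>x. - mon (- w) * x) ` right_comb f n"
    unfolding right_comb_def by (simp add: image_image sum_distrib_left mult.assoc sum_negf)
  also have "\<dots> = right_comb f n"
  proof (rule translate_right_ideal)
    show "right_ideal (right_comb f n)"
      by (rule right_ideal_right_basis[OF right_basis_right_free[OF f]])
    show "mon w - 1 \<in> right_comb f n" unfolding q right_comb_def by blast
  qed
  finally show "iota ` Q_dual (mon w - 1) (right_comb (\<lambda>i. iota (b i)) n) = right_comb f n" .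
qed

theorem theorem1p5:
  fixes X :: "'f::group_add set" and w :: 'f
  assumes "finite X" and "free_group_basis X"
  shows "let q = (Poly_Mapping.single w 1 - 1 :: 'f \<Rightarrow>\<^sub>0 'k::field);
             Alg = {I. algebraic_extension (right_span {q}) I};
             \<Phi> = (\<lambda>I. iota ` Q_dual q I)
         in (\<forall>I\<in>Alg. \<Phi> I \<in> Alg \<and> \<Phi> (\<Phi> I) = I) \<and>
            (\<forall>I\<in>Alg. right_rank (\<Phi> I) = right_rank I) \<and>
            (\<forall>I\<in>Alg. \<forall>J\<in>Alg. I \<subseteq> J \<longrightarrow> \<Phi> J \<subseteq> \<Phi> I)"
proof -
  interpret free_group X by unfold_locales (rule assms(2))
  define q :: "'f \<Rightarrow>\<^sub>0 'k" where "q = mon w - 1"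
  have dual: "algebraic_extension (right_span {q}) (iota ` Q_dual q I) \<and>
      iota ` Q_dual q (iota ` Q_dual q I) = I \<and>
      right_rank (iota ` Q_dual q I) = right_rank I"
    if alg: "algebraic_extension (right_span {q}) I" for I
  proof -
    obtain f b n where fb: "right_free f n" "left_free b n" "q = (\<Sum>i<n. f i * b i)"
      and I: "I = right_comb f n"
      using algebraic_extension_factorization[OF right_ideal_has_basis alg] by blast
    note hom = augmentation_one augmentation_add augmentation_mult
    note dual = iota_Q_dual[OF fb(1,2) fb(3)[unfolded q_def], folded q_def]
    show ?thesis
      unfolding I dual(1)
      using dual(2,3) right_rank_right_comb[OF hom fb(1)]
        right_rank_right_comb[OF hom right_free_iota[OF fb(2)]] by simp
  qed
  have antimono: "iota ` Q_dual q J \<subseteq> iota ` Q_dual q I"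
    if I: "algebraic_extension (right_span {q}) I" and J: "algebraic_extension (right_span {q}) J"
      and le: "I \<subseteq> J" for I J
  proof -
    have "right_ideal I" "right_ideal J" "q \<in> I"
      using I J right_span_superset[of "{q}"] unfolding algebraic_extension_def by auto
    moreover from this obtain B C where "right_basis B I" "right_basis C J"
      using right_ideal_has_basis by blast
    ultimately show ?thesis
      using le by (intro image_mono Q_dual_antimono)
  qed
  show ?thesis
    unfolding Let_def q_def[symmetric] using dual antimono by auto
qed

end
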